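(* Let $C\ge1$ be an integer and $0<\lambda<C$. For $N\ge1$ let $Y^N$ be the irreducible Markov jump process on $\mathcal Y^N=\{y\in\mathcal Y:Ny_n\in\mathbb N\text{ for }n=0,\dots,C\}$ with transitions - $y\to y+\frac1N(e_{n+1}-e_n)$ at rate $\lambda N\frac{y_n}{1-y_C}\mathbf 1_{y_C<1}$, for $0\le n\le C-1$; - $y\to y+\frac1N(e_{n-1}-e_n)$ at rate $Nn\,y_n$, for $1\le n\le C$; and let $\pi^N$ be its invariant distribution. Then, as $N$ goes to infinity, $\pi^N$ converges weakly (as a probability measure on $\mathcal Y$) to the Dirac mass at $\nu_{\rho_\lambda}$, where $\rho_\lambda$ is the unique $\rho\in(0,\infty)$ such that $\sum_{n=0}^Cn\,\nu_\rho(n)=\lambda$.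
   Context: $\mathcal Y=\{y=(y_0,\dots,y_C)\in[0,\infty)^{C+1}:\sum_ny_n=1\}$ is the set of probability measures on $\{0,\dots,C\}$, $e_n$ the $n$-th unit vector of $\mathbb R^{C+1}$ (indexed $0,\dots,C$). For $\rho>0$, $\nu_\rho\in\mathcal Y$ is the Erlang distribution $\nu_\rho(n)=\frac{1}{Z(\rho)}\frac{\rho^n}{n!}$, $0\le n\le C$, with $Z(\rho)=\sum_{n=0}^C\rho^n/n!$. ($Y^N$ is the empirical distribution of the numbers of customers at $N$ nodes of capacity $C$, where customers arrive at total rate $\lambda N$, are each directed to a node chosen uniformly among non-saturated nodes, are rejected if all nodes are saturated, and stay for an exponential time of mean $1$.) *)

theory Defs
  imports "HOL-Probability.Probability"
begin

section \<open>Markov jump processes with finite state space\<close>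

text \<open>A jump process on a finite set \<open>S\<close> is given by its rates \<open>q x y\<close>, for distinct \<open>x\<close> and
  \<open>y\<close> in \<open>S\<close>. The values \<open>q x x\<close> play no role.\<close>

definition Q_matrix :: "'s set \<Rightarrow> ('s \<Rightarrow> 's \<Rightarrow> real) \<Rightarrow> 's \<Rightarrow> 's \<Rightarrow> real" where
  "Q_matrix S q x y = (if x = y then - (\<Sum>z\<in>S - {x}. q x z) else q x y)"

primrec Q_power :: "'s set \<Rightarrow> ('s \<Rightarrow> 's \<Rightarrow> real) \<Rightarrow> nat \<Rightarrow> 's \<Rightarrow> 's \<Rightarrow> real" where
  "Q_power S q 0 x y = (if x = y then 1 else 0)"
| "Q_power S q (Suc k) x y = (\<Sum>z\<in>S. Q_power S q k x z * Q_matrix S q z y)"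

text \<open>The matrix exponential of \<open>t Q\<close>: for \<open>x\<close> and \<open>y\<close> in \<open>S\<close>, the probability that the process
  started at \<open>x\<close> is at \<open>y\<close> at time \<open>t\<close>. The series converges absolutely as \<open>S\<close> is finite.\<close>

definition transition_prob ::
    "'s set \<Rightarrow> ('s \<Rightarrow> 's \<Rightarrow> real) \<Rightarrow> real \<Rightarrow> 's \<Rightarrow> 's \<Rightarrow> real" where
  "transition_prob S q t x y = (\<Sum>k. t ^ k / fact k * Q_power S q k x y)"

definition irreducible_jump :: "'s set \<Rightarrow> ('s \<Rightarrow> 's \<Rightarrow> real) \<Rightarrow> bool" where
  "irreducible_jump S q \<longleftrightarrow>
     (\<forall>x\<in>S. \<forall>y\<in>S. (x, y) \<in> {(u, v). u \<in> S \<and> v \<in> S \<and> u \<noteq> v \<and> q u v > 0}\<^sup>*)"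

definition invariant_distribution ::
    "'s set \<Rightarrow> ('s \<Rightarrow> 's \<Rightarrow> real) \<Rightarrow> 's pmf \<Rightarrow> bool" where
  "invariant_distribution S q p \<longleftrightarrow> set_pmf p \<subseteq> S \<and>
     (\<forall>t\<ge>0. \<forall>y\<in>S. (\<Sum>x\<in>S. pmf p x * transition_prob S q t x y) = pmf p y)"


section \<open>Weak convergence\<close>

definition weak_conv_on ::
    "'a::topological_space set \<Rightarrow> (nat \<Rightarrow> 'a measure) \<Rightarrow> 'a measure \<Rightarrow> bool" where
  "weak_conv_on S M M' \<longleftrightarrow>
     (\<forall>f :: 'a \<Rightarrow> real. continuous_on S f \<and> bounded (f ` S) \<longrightarrow>
        (\<lambda>n. \<integral>x. f x \<partial>M n) \<longlonglongrightarrow> (\<integral>x. f x \<partial>M'))"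

text \<open>A \<open>pmf\<close> carries the discrete sigma-algebra; this is the same distribution as a Borel measure
  on \<open>S\<close>.\<close>

definition borel_law :: "'a::topological_space set \<Rightarrow> 'a pmf \<Rightarrow> 'a measure" where
  "borel_law S p = distr (measure_pmf p) (restrict_space borel S) (\<lambda>x. x)"


section \<open>The network\<close>

text \<open>Vectors of dimension \<open>C + 1\<close> are functions on \<open>nat\<close> that vanish beyond \<open>C\<close>. On these, the
  topology of \<open>nat \<Rightarrow> real\<close> is that of coordinatewise convergence, i.e. the Euclidean one.\<close>

definition prob_vectors :: "nat \<Rightarrow> (nat \<Rightarrow> real) set" where
  "prob_vectors C = {y. (\<forall>n\<le>C. 0 \<le> y n) \<and> (\<forall>n>C. y n = 0) \<and> (\<Sum>n\<le>C. y n) = 1}"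

definition network_states :: "nat \<Rightarrow> nat \<Rightarrow> (nat \<Rightarrow> real) set" where
  "network_states C N = {y \<in> prob_vectors C. \<forall>n\<le>C. real N * y n \<in> \<nat>}"

definition unit_vector :: "nat \<Rightarrow> nat \<Rightarrow> real" where
  "unit_vector n = (\<lambda>i. if i = n then 1 else 0)"

definition move :: "nat \<Rightarrow> nat \<Rightarrow> nat \<Rightarrow> (nat \<Rightarrow> real) \<Rightarrow> nat \<Rightarrow> real" where
  "move N n m y = (\<lambda>i. y i + (unit_vector m i - unit_vector n i) / real N)"

text \<open>For \<open>N \<ge> 1\<close> at most one summand is nonzero, as the moves lead to distinct states.\<close>

definition network_rate ::
    "nat \<Rightarrow> real \<Rightarrow> nat \<Rightarrow> (nat \<Rightarrow> real) \<Rightarrow> (nat \<Rightarrow> real) \<Rightarrow> real" where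
  "network_rate C lam N y y' =
     (\<Sum>n<C. if y' = move N n (n + 1) y
             then (if y C < 1 then lam * real N * (y n / (1 - y C)) else 0) else 0) +
     (\<Sum>n=1..C. if y' = move N n (n - 1) y then real N * real n * y n else 0)"

definition erlang :: "nat \<Rightarrow> real \<Rightarrow> nat \<Rightarrow> real" where
  "erlang C \<rho> n =
     (if n \<le> C then (\<rho> ^ n / fact n) / (\<Sum>k\<le>C. \<rho> ^ k / fact k) else 0)"

end

theory Submission
  imports Defs "HOL-Real_Asymp.Real_Asymp"
begin

text \<open>
  Let \<open>m(y) = \<Sum> n y\<^sub>n\<close> and \<open>u = \<lambda> / (1 - y\<^sub>C)\<close>. The number of customers is autonomous up to the states
  with \<open>y\<^sub>C = 1\<close>, and applying the generator to \<open>(m - \<lambda>)\<^sup>2\<close> gives \<open>E (m - \<lambda>)\<^sup>2 = O(1/N)\<close> under the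
  invariant law. For the mean-field flow, the free energy \<open>\<Sum> y\<^sub>n ln (n! y\<^sub>n)\<close> has derivative
  \<open>\<Sum> (u y\<^sub>n - (n+1) y\<^sub>n\<^sub>+\<^sub>1) ln ((n+1) y\<^sub>n\<^sub>+\<^sub>1 / (u y\<^sub>n)) + (\<lambda> - m) ln u\<close>.
  Here the first sum is at most \<open>-2 \<Sum> (sqrt (u y\<^sub>n) - sqrt ((n+1) y\<^sub>n\<^sub>+\<^sub>1))\<^sup>2\<close>, and the second term is negligible
  since \<open>m\<close> concentrates at \<open>\<lambda>\<close> and \<open>ln u = O(ln N)\<close>. Hence the dissipation tends to \<open>0\<close> in
  expectation. Together with \<open>m = \<lambda>\<close> it vanishes only at the Erlang distribution of mean \<open>\<lambda>\<close>,
  and compactness of the simplex gives the weak convergence.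
\<close>

section \<open>Finite jump processes\<close>

lemma Q_matrix_sum_right:
  assumes "finite S" "x \<in> S"
  shows "(\<Sum>y\<in>S. Q_matrix S q x y * f y) = (\<Sum>y\<in>S. q x y * (f y - f x))"
proof -
  have "(\<Sum>y\<in>S. Q_matrix S q x y * f y)
      = - (\<Sum>z\<in>S - {x}. q x z) * f x + (\<Sum>y\<in>S - {x}. q x y * f y)"
    using assms by (simp add: sum.remove[of S x]) (auto simp: Q_matrix_def split: if_splits intro!: sum.cong)
  also have "\<dots> = (\<Sum>y\<in>S - {x}. q x y * (f y - f x))"
    by (simp add: right_diff_distrib sum_subtractf sum_distrib_right)
  also have "\<dots> = (\<Sum>y\<in>S. q x y * (f y - f x))"
    using assms by (simp add: sum.remove)
  finally show ?thesis .
qed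

text \<open>The term \<open>p y * q y y\<close> occurs in both sums on the right and cancels, so
  inflow and outflow may be summed over all of \<open>S\<close>.\<close>

lemma Q_matrix_sum_left:
  assumes "finite S" "y \<in> S"
  shows "(\<Sum>x\<in>S. p x * Q_matrix S q x y) = (\<Sum>x\<in>S. p x * q x y) - p y * (\<Sum>z\<in>S. q y z)"
proof -
  have "(\<Sum>x\<in>S. p x * Q_matrix S q x y)
      = - p y * (\<Sum>z\<in>S - {y}. q y z) + (\<Sum>x\<in>S - {y}. p x * q x y)"
    using assms by (simp add: sum.remove) (auto simp: Q_matrix_def split: if_splits intro!: sum.cong)
  also have "\<dots> = (\<Sum>x\<in>S. p x * q x y) - p y * (\<Sum>z\<in>S. q y z)"
    using assms by (simp add: sum.remove algebra_simps)
  finally show ?thesis .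
qed

text \<open>A crude geometric bound: multiplying by \<open>Q\<close> costs at most the sum of the
  absolute values of all its entries. It dominates the matrix exponential by a scalar exponential
  series.\<close>

lemma abs_Q_power_le:
  assumes "finite S" "y \<in> S"
  shows "\<bar>Q_power S q k x y\<bar> \<le> (\<Sum>a\<in>S. \<Sum>b\<in>S. \<bar>Q_matrix S q a b\<bar>) ^ k"
  using assms(2)
proof (induction k arbitrary: y)
  case (Suc k)
  let ?B = "\<Sum>a\<in>S. \<Sum>b\<in>S. \<bar>Q_matrix S q a b\<bar>"
  have B0: "0 \<le> ?B" by (intro sum_nonneg) auto
  have "\<bar>Q_power S q (Suc k) x y\<bar> \<le> (\<Sum>z\<in>S. \<bar>Q_power S q k x z * Q_matrix S q z y\<bar>)"
    by (simp add: sum_abs)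
  also have "\<dots> \<le> (\<Sum>z\<in>S. ?B ^ k * (\<Sum>b\<in>S. \<bar>Q_matrix S q z b\<bar>))"
    unfolding abs_mult
    by (intro sum_mono mult_mono Suc.IH member_le_sum) (use Suc.prems assms(1) B0 in auto)
  also have "\<dots> = ?B ^ Suc k" by (simp only: sum_distrib_left[symmetric] power_Suc2)
  finally show ?case .
qed auto

lemma summable_transition_series:
  assumes "finite S" "y \<in> S"
  shows "summable (\<lambda>k. t ^ k / fact k * Q_power S q k x y)"
proof (rule summable_comparison_test')
  let ?B = "\<Sum>a\<in>S. \<Sum>b\<in>S. \<bar>Q_matrix S q a b\<bar>"
  show "summable (\<lambda>k. inverse (fact k) * (\<bar>t\<bar> * ?B) ^ k)" by (rule summable_exp)
  show "norm (t ^ k / fact k * Q_power S q k x y) \<le> inverse (fact k) * (\<bar>t\<bar> * ?B) ^ k" for k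
    using mult_left_mono[OF abs_Q_power_le[OF assms, of q k x], of "\<bar>t\<bar> ^ k / fact k"]
    by (simp add: abs_mult power_mult_distrib power_abs divide_simps mult.commute)
qed

text \<open>The row vector \<open>p exp(tQ)\<close> is a power series in \<open>t\<close> with
  coefficients \<open>p Q^k / k!\<close>, here \<open>a k y / fact k\<close>. If it is constant, its
  linear coefficient \<open>p Q\<close> vanishes; conversely \<open>p Q = 0\<close> kills every term
  with \<open>k > 0\<close>.\<close>

lemma invariant_distribution_iff_balance:
  assumes S: "finite S"
  shows "invariant_distribution S q p \<longleftrightarrow>
    set_pmf p \<subseteq> S \<and> (\<forall>y\<in>S. (\<Sum>x\<in>S. pmf p x * Q_matrix S q x y) = 0)"
proof -
  define a where "a k y = (\<Sum>x\<in>S. pmf p x * Q_power S q k x y)" for k y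
  have a0: "a 0 y = pmf p y" if "y \<in> S" for y
    using that S by (simp add: a_def if_distrib cong: if_cong)
  have a_Suc: "a (Suc k) y = (\<Sum>z\<in>S. a k z * Q_matrix S q z y)" for k y
  proof -
    have "a (Suc k) y = (\<Sum>x\<in>S. \<Sum>z\<in>S. pmf p x * Q_power S q k x z * Q_matrix S q z y)"
      by (simp add: a_def sum_distrib_left mult.assoc)
    also have "\<dots> = (\<Sum>z\<in>S. a k z * Q_matrix S q z y)"
      unfolding a_def sum_distrib_right by (rule sum.swap)
    finally show ?thesis .
  qed
  have a1: "a 1 y = (\<Sum>x\<in>S. pmf p x * Q_matrix S q x y)" for y
    using a_Suc[of 0 y] by (simp add: a0)
  have series: "(\<lambda>k. a k y / fact k * t ^ k) sums (\<Sum>x\<in>S. pmf p x * transition_prob S q t x y)"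
    if y: "y \<in> S" for t y
  proof -
    have "(\<lambda>k. pmf p x * (t ^ k / fact k * Q_power S q k x y)) sums
        (pmf p x * transition_prob S q t x y)" for x
      unfolding transition_prob_def
      by (intro sums_mult summable_sums summable_transition_series S y)
    then have "(\<lambda>k. \<Sum>x\<in>S. pmf p x * (t ^ k / fact k * Q_power S q k x y)) sums
        (\<Sum>x\<in>S. pmf p x * transition_prob S q t x y)"
      by (intro sums_sum)
    moreover have "(\<Sum>x\<in>S. pmf p x * (t ^ k / fact k * Q_power S q k x y)) = a k y / fact k * t ^ k" for k
      unfolding a_def sum_divide_distrib sum_distrib_right by (simp add: mult_ac)
    ultimately show ?thesis by simp
  qed
  show ?thesis
  proof (cases "set_pmf p \<subseteq> S")
    case True
    have "a 1 y = 0"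
      if y: "y \<in> S" and all: "(\<forall>t\<ge>0. (\<Sum>x\<in>S. pmf p x * transition_prob S q t x y) = pmf p y)" for y
    proof -
      \<comment> \<open>Constancy is known only for \<open>t \<ge> 0\<close>. The series without its
        constant term is therefore divided by \<open>t\<close>, and a limit at 0 from the right
        reads off the linear coefficient.\<close>
      define c where "c k = a (Suc k) y / fact (Suc k)" for k
      define g where "g t = (\<Sum>k. c k * t ^ k)" for t :: real
      have full: "(\<lambda>k. c k * t ^ k * t) sums ((\<Sum>x\<in>S. pmf p x * transition_prob S q t x y) - pmf p y)" for t
        using sums_Suc_iff[of "\<lambda>k. a k y / fact k * t ^ k"
            "(\<Sum>x\<in>S. pmf p x * transition_prob S q t x y) - pmf p y"] series[OF y, of t] a0[OF y]
        by (simp add: c_def mult_ac)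
      have g: "(\<lambda>k. c k * t ^ k) sums g t" for t
      proof (cases "t = 0")
        case True
        then show ?thesis by (simp add: g_def powser_sums_zero)
      next
        case False
        then have "summable (\<lambda>k. c k * t ^ k)"
          using sums_summable[OF full[of t]] summable_mult2[of _ "inverse t"]
          by (simp add: summable_cmult_iff mult.commute)
        then show ?thesis by (simp add: g_def summable_sums)
      qed
      have "g t = 0" if "t > 0" for t
      proof -
        have "g t * t = 0"
          using sums_unique2[OF sums_mult2[OF g[of t], of t] full[of t]] all that by auto
        then show ?thesis using that by simp
      qed
      then have "(g \<longlongrightarrow> 0) (at_right 0)"
        by (intro tendsto_eventually) (auto simp: eventually_at_right_less eventually_at_filter)
      moreover have "(g \<longlongrightarrow> c 0) (at_right 0)"
        by (rule tendsto_mono[OF _ powser_limit_0[of 1 c g]]) (use g in \<open>auto simp: at_le\<close>)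
      ultimately have "c 0 = 0"
        using tendsto_unique[OF trivial_limit_at_right_real] by blast
      then show ?thesis by (simp add: c_def)
    qed
    moreover have "(\<Sum>x\<in>S. pmf p x * transition_prob S q t x y) = pmf p y"
      if y: "y \<in> S" and bal: "\<forall>y\<in>S. a 1 y = 0" for y t
    proof -
      have "a (Suc k) z = 0" if "z \<in> S" for k z
        using that by (induction k arbitrary: z) (use bal a_Suc in auto)
      then have "a k y / fact k * t ^ k = (if k = 0 then pmf p y else 0)" for k
        using y a0 by (cases k) auto
      then have "(\<lambda>k. if k = 0 then pmf p y else 0) sums (\<Sum>x\<in>S. pmf p x * transition_prob S q t x y)"
        using series[OF y, of t] by simp
      then show ?thesis
        using sums_unique2 sums_single[of 0 "\<lambda>_. pmf p y"] by auto
    qed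
    ultimately show ?thesis
      unfolding invariant_distribution_def a1[symmetric] using True by blast
  qed (simp add: invariant_distribution_def)
qed

text \<open>State elimination: the chain watched only outside \<open>s\<close> has rates
  \<open>q x y + q x s * q s y / r\<close>, where \<open>r\<close> is the total rate out of \<open>s\<close>.\<close>

lemma exists_balanced_weights:
  fixes q :: "'s \<Rightarrow> 's \<Rightarrow> real"
  assumes "finite S" "S \<noteq> {}" "\<And>x y. 0 \<le> q x y"
  shows "\<exists>p. (\<forall>x\<in>S. 0 \<le> p x) \<and> 0 < sum p S \<and>
    (\<forall>y\<in>S. (\<Sum>x\<in>S. p x * q x y) = p y * (\<Sum>z\<in>S. q y z))"
  using assms
proof (induction S arbitrary: q rule: finite_induct)
  case (insert s S)
  define r where "r = (\<Sum>z\<in>S. q s z)"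
  show ?case
  proof (cases "r = 0")
    case True
    then have "q s z = 0" if "z \<in> S" for z
      using that insert.hyps insert.prems sum_nonneg_eq_0_iff[of S "q s"] by (auto simp: r_def)
    \<comment> \<open>No rate leads from \<open>s\<close> into \<open>S\<close>, so the point mass
      at \<open>s\<close> is balanced.\<close>
    then show ?thesis
      using insert.hyps
      by (intro exI[of _ "\<lambda>x. if x = s then 1 else 0"])
        (auto simp: if_distrib intro!: sum.neutral cong: if_cong)
  next
    case False
    then have r: "r > 0"
      using insert.prems sum_nonneg[of S "q s"] by (simp add: r_def order_less_le)
    then have "S \<noteq> {}" by (auto simp: r_def)
    define q' where "q' x y = q x y + q x s * q s y / r" for x y
    have "0 \<le> q' x y" for x y using insert.prems r by (simp add: q'_def)
    then obtain p' where p': "\<And>x. x \<in> S \<Longrightarrow> 0 \<le> p' x" "0 < sum p' S"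
        "\<And>y. y \<in> S \<Longrightarrow> (\<Sum>x\<in>S. p' x * q' x y) = p' y * (\<Sum>z\<in>S. q' y z)"
      using insert.IH[of q'] \<open>S \<noteq> {}\<close> by blast
    \<comment> \<open>Balance at \<open>s\<close> forces this weight: the inflow from
      \<open>S\<close> divided by the outflow rate \<open>r\<close>.\<close>
    define w where "w = (\<Sum>x\<in>S. p' x * q x s) / r"
    define p where "p = p'(s := w)"
    have w: "w \<ge> 0" unfolding w_def using p' insert.prems r by (auto intro!: sum_nonneg divide_nonneg_pos)
    have pS: "p x = p' x" if "x \<in> S" for x using that insert.hyps by (auto simp: p_def)
    have ps: "p s = w" by (simp add: p_def)
    have sumS: "(\<Sum>x\<in>S. p x * h x) = (\<Sum>x\<in>S. p' x * h x)" for h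
      by (intro sum.cong) (auto simp: pS)
    have "(\<Sum>x\<in>insert s S. p x * q x y) = p y * (\<Sum>z\<in>insert s S. q y z)" if y: "y \<in> insert s S" for y
    proof (cases "y = s")
      case True
      then show ?thesis
        using insert.hyps r by (simp add: ps sumS w_def r_def[symmetric] field_simps)
    next
      case False
      then have y: "y \<in> S" using y by auto
      have "(\<Sum>x\<in>S. p' x * q' x y) = (\<Sum>x\<in>S. p' x * q x y) + w * q s y"
        by (simp add: q'_def w_def algebra_simps sum.distrib sum_distrib_left sum_divide_distrib)
      moreover have "(\<Sum>z\<in>S. q' y z) = (\<Sum>z\<in>S. q y z) + q y s * (r / r)"
        by (simp only: q'_def r_def sum.distrib sum_divide_distrib sum_distrib_left)
          (simp add: sum_divide_distrib)
      ultimately show ?thesis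
        using p'(3)[OF y] insert.hyps r by (simp add: ps sumS pS y add.commute)
    qed
    moreover have "sum p (insert s S) > 0"
      using insert.hyps p'(2) w sumS[of "\<lambda>_. 1"] by (simp add: ps)
    ultimately show ?thesis
      using w p' ps pS by (intro exI[of _ p]) auto
  qed
qed simp

text \<open>At a zero of \<open>w\<close> the balance equation says that the total inflow is 0. By
  nonnegativity every state with a positive rate into it has weight 0 too, and irreducibility
  carries this backwards along a path from \<open>x\<close> to \<open>z\<close>.\<close>

lemma balanced_zero_spreads:
  fixes q :: "'s \<Rightarrow> 's \<Rightarrow> real"
  assumes S: "finite S" and q: "\<And>x y. x \<in> S \<Longrightarrow> y \<in> S \<Longrightarrow> 0 \<le> q x y" and irr: "irreducible_jump S q"
    and w: "\<And>x. x \<in> S \<Longrightarrow> 0 \<le> w x"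
    and bal: "\<And>y. y \<in> S \<Longrightarrow> (\<Sum>x\<in>S. w x * Q_matrix S q x y) = 0"
    and z: "z \<in> S" "w z = 0" and x: "x \<in> S"
  shows "w x = 0"
proof -
  have "(x, z) \<in> {(u, v). u \<in> S \<and> v \<in> S \<and> u \<noteq> v \<and> q u v > 0}\<^sup>*"
    using irr x z unfolding irreducible_jump_def by blast
  then show ?thesis
  proof (induction rule: converse_rtrancl_induct)
    case (step u v)
    then have uv: "u \<in> S" "v \<in> S" "q u v > 0" by auto
    have "(\<Sum>x\<in>S. w x * q x v) = 0"
      using bal[OF uv(2)] step.IH Q_matrix_sum_left[OF S uv(2), of w q] by simp
    then have "w u * q u v = 0"
      using sum_nonneg_eq_0_iff[OF S, of "\<lambda>x. w x * q x v"] w q uv by auto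
    then show ?case using uv by simp
  qed (rule z)
qed

text \<open>Existence normalises balanced weights. For uniqueness, the largest multiple of
  \<open>p\<close> lying below \<open>p'\<close> is subtracted from \<open>p'\<close>: the
  difference is nonnegative, balanced and zero at some state, hence zero on
  \<open>S\<close>.\<close>

lemma ex1_invariant_distribution:
  fixes q :: "'s \<Rightarrow> 's \<Rightarrow> real"
  assumes S: "finite S" "S \<noteq> {}" and q: "\<And>x y. x \<in> S \<Longrightarrow> y \<in> S \<Longrightarrow> 0 \<le> q x y"
    and irr: "irreducible_jump S q"
  shows "\<exists>!p. invariant_distribution S q p"
proof (rule ex_ex1I)
  obtain p where p: "\<And>x. x \<in> S \<Longrightarrow> 0 \<le> p x" "0 < sum p S"
    "\<And>y. y \<in> S \<Longrightarrow> (\<Sum>x\<in>S. p x * \<bar>q x y\<bar>) = p y * (\<Sum>z\<in>S. \<bar>q y z\<bar>)"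
    \<comment> \<open>The absolute values make the rates nonnegative on the whole type; on
      \<open>S\<close> they agree with \<open>q\<close>.\<close>
    using exists_balanced_weights[OF S, of "\<lambda>x y. \<bar>q x y\<bar>"] by auto
  define f where "f x = (if x \<in> S then p x / sum p S else 0)" for x
  have f0: "0 \<le> f x" for x using p by (simp add: f_def)
  have sub: "{x. f x \<noteq> 0} \<subseteq> S" by (auto simp: f_def)
  have "(\<integral>\<^sup>+ x. ennreal (f x) \<partial>count_space UNIV) = (\<Sum>x\<in>S. ennreal (f x))"
    using S by (intro nn_integral_count_space') (auto simp: f_def)
  also have "\<dots> = ennreal (\<Sum>x\<in>S. f x)" using f0 by (simp add: sum_ennreal)
  also have "(\<Sum>x\<in>S. f x) = 1" using p(2) by (simp add: f_def sum_divide_distrib[symmetric])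
  finally have nn: "(\<integral>\<^sup>+ x. ennreal (f x) \<partial>count_space UNIV) = 1" by simp
  have pmf: "pmf (embed_pmf f) = f" using pmf_embed_pmf[of f] f0 nn by auto
  have "(\<Sum>x\<in>S. f x * Q_matrix S q x y) = 0" if y: "y \<in> S" for y
  proof -
    have "(\<Sum>x\<in>S. f x * Q_matrix S q x y) = (\<Sum>x\<in>S. p x * Q_matrix S q x y) / sum p S"
      by (simp add: f_def sum_divide_distrib)
    moreover have "(\<Sum>x\<in>S. p x * \<bar>q x y\<bar>) = (\<Sum>x\<in>S. p x * q x y)" "(\<Sum>z\<in>S. \<bar>q y z\<bar>) = (\<Sum>z\<in>S. q y z)"
      using q y by (auto intro!: sum.cong)
    ultimately show ?thesis
      using p(3)[OF y] Q_matrix_sum_left[OF S(1) y, of p q] by simp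
  qed
  then have "invariant_distribution S q (embed_pmf f)"
    unfolding invariant_distribution_iff_balance[OF S(1)] using sub by (simp add: set_pmf_iff pmf subset_iff)
  then show "\<exists>p. invariant_distribution S q p" ..
next
  fix p p' assume *: "invariant_distribution S q p" "invariant_distribution S q p'"
  have sub: "set_pmf p \<subseteq> S" "set_pmf p' \<subseteq> S"
    and bal: "\<And>y. y \<in> S \<Longrightarrow> (\<Sum>x\<in>S. pmf p x * Q_matrix S q x y) = 0"
      "\<And>y. y \<in> S \<Longrightarrow> (\<Sum>x\<in>S. pmf p' x * Q_matrix S q x y) = 0"
    using * unfolding invariant_distribution_iff_balance[OF S(1)] by auto
  have one: "(\<Sum>x\<in>S. pmf p x) = 1" "(\<Sum>x\<in>S. pmf p' x) = 1"
    using sum_pmf_eq_1[OF S(1)] sub by auto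
  have pos: "pmf p x > 0" if "x \<in> S" for x
  proof (rule ccontr)
    assume "\<not> pmf p x > 0"
    then have "pmf p x = 0" using pmf_nonneg[of p x] by linarith
    then have "pmf p y = 0" if "y \<in> S" for y
      by (intro balanced_zero_spreads[OF S(1) q irr _ bal(1) \<open>x \<in> S\<close> _ that]) auto
    then show False using one by simp
  qed
  \<comment> \<open>The largest factor with \<open>c * pmf p \<le> pmf p'\<close> on
    \<open>S\<close>, attained at \<open>z\<close>.\<close>
  define c where "c = Min ((\<lambda>x. pmf p' x / pmf p x) ` S)"
  have "c \<in> (\<lambda>x. pmf p' x / pmf p x) ` S" unfolding c_def using S by (intro Min_in) auto
  then obtain z where z: "z \<in> S" "c = pmf p' z / pmf p z" by auto
  define w where "w x = pmf p' x - c * pmf p x" for x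
  have "w x = 0" if x: "x \<in> S" for x
  proof (rule balanced_zero_spreads[OF S(1) q irr _ _ z(1) _ x])
    show "w z = 0" using z pos[OF z(1)] by (simp add: w_def)
    show "0 \<le> w y" if "y \<in> S" for y
    proof -
      have "c \<le> pmf p' y / pmf p y" unfolding c_def using S that by (intro Min_le) auto
      then show ?thesis using pos[OF that] by (simp add: w_def field_simps)
    qed
    show "(\<Sum>x\<in>S. w x * Q_matrix S q x y) = 0" if "y \<in> S" for y
    proof -
      have "(\<Sum>x\<in>S. w x * Q_matrix S q x y) =
          (\<Sum>x\<in>S. pmf p' x * Q_matrix S q x y) - c * (\<Sum>x\<in>S. pmf p x * Q_matrix S q x y)"
        by (simp add: w_def algebra_simps sum_subtractf sum_distrib_left)
      then show ?thesis using bal that by simp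
    qed
  qed auto
  then have eq: "pmf p' x = c * pmf p x" if "x \<in> S" for x using that by (simp add: w_def)
  then have "c = 1" using one by (simp add: sum_distrib_left[symmetric])
  have "pmf p' x = pmf p x" for x
  proof (cases "x \<in> S")
    case True
    then show ?thesis using eq \<open>c = 1\<close> by simp
  next
    case False
    then have "x \<notin> set_pmf p" "x \<notin> set_pmf p'" using sub by blast+
    then show ?thesis by (simp add: set_pmf_iff)
  qed
  then show "p = p'" by (metis pmf_eqI)
qed

text \<open>Pairing the balance equations with a test function \<open>f\<close>: the generator
  applied to \<open>f\<close> has expectation 0. The squared deviation of the mean and the entropy
  are the test functions used below.\<close>

lemma invariant_expectation_generator:
  assumes S: "finite S" and inv: "invariant_distribution S q p"
  shows "(\<Sum>x\<in>S. pmf p x * (\<Sum>y\<in>S. q x y * (f y - f x))) = 0"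
proof -
  have "(\<Sum>x\<in>S. pmf p x * (\<Sum>y\<in>S. q x y * (f y - f x)))
      = (\<Sum>x\<in>S. \<Sum>y\<in>S. pmf p x * Q_matrix S q x y * f y)"
    by (intro sum.cong) (simp_all add: Q_matrix_sum_right[OF S, symmetric] sum_distrib_left mult.assoc)
  also have "\<dots> = (\<Sum>y\<in>S. (\<Sum>x\<in>S. pmf p x * Q_matrix S q x y) * f y)"
    unfolding sum_distrib_right by (rule sum.swap)
  also have "\<dots> = 0"
    using inv unfolding invariant_distribution_iff_balance[OF S] by simp
  finally show ?thesis .
qed

section \<open>The generator of the network\<close>

definition mean :: "nat \<Rightarrow> (nat \<Rightarrow> real) \<Rightarrow> real" where
  "mean C y = (\<Sum>n\<le>C. real n * y n)"

section \<open>The simplex, its lattice points and single moves\<close>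

lemma prob_vectorsD:
  assumes "y \<in> prob_vectors C"
  shows "0 \<le> y n" "n > C \<Longrightarrow> y n = 0" "(\<Sum>n\<le>C. y n) = 1"
  using assms by (cases "n \<le> C"; force simp: prob_vectors_def)+

lemma prob_vectors_le_1:
  assumes "y \<in> prob_vectors C"
  shows "y n \<le> 1"
proof (cases "n \<le> C")
  case True
  then have "y n \<le> (\<Sum>n\<le>C. y n)"
    using prob_vectorsD[OF assms] by (intro member_le_sum) auto
  then show ?thesis using prob_vectorsD[OF assms] by simp
qed (use prob_vectorsD[OF assms] in auto)

lemma prob_vectors_sum_lessThan:
  assumes "y \<in> prob_vectors C"
  shows "(\<Sum>n<C. y n) = 1 - y C"
  using prob_vectorsD(3)[OF assms] by (simp flip: lessThan_Suc_atMost)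

lemma mean_bounds:
  assumes "y \<in> prob_vectors C"
  shows "0 \<le> mean C y" "real C * y C \<le> mean C y" "mean C y \<le> real C"
proof -
  have nn: "0 \<le> real n * y n" for n using prob_vectorsD[OF assms] by simp
  show "0 \<le> mean C y" unfolding mean_def by (intro sum_nonneg nn)
  show "real C * y C \<le> mean C y" unfolding mean_def
    by (rule member_le_sum[of C _ "\<lambda>n. real n * y n"]) (use nn in auto)
  have "mean C y \<le> (\<Sum>n\<le>C. real C * y n)" unfolding mean_def
    by (intro sum_mono mult_right_mono) (use prob_vectorsD[OF assms] in auto)
  then show "mean C y \<le> real C"
    using prob_vectorsD(3)[OF assms] by (simp flip: sum_distrib_left)
qed

lemma mean_eq_sum_lessThan:
  "mean C y = (\<Sum>n<C. real (Suc n) * y (Suc n))"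
  unfolding mean_def lessThan_Suc_atMost[symmetric] sum.lessThan_Suc_shift by simp

lemma network_statesD:
  assumes "y \<in> network_states C N"
  shows "y \<in> prob_vectors C" "real N * y n \<in> \<nat>"
  using assms prob_vectorsD(2)[of y C n]
  by (cases "n \<le> C"; simp add: network_states_def)+

lemma network_states_ge_1:
  assumes "y \<in> network_states C N" "N \<ge> 1" "y n > 0"
  shows "real N * y n \<ge> 1"
proof -
  obtain k where "real N * y n = real k"
    using network_statesD[OF assms(1)] by (auto elim: Nats_cases)
  moreover have "real N * y n > 0" using assms by simp
  ultimately show ?thesis by simp
qed

text \<open>\<open>N * y C\<close> is an integer below \<open>N\<close>. This granularity keeps the
  arrival rate per non-saturated node at most \<open>lam * N\<close>, and hence its logarithm of
  order \<open>ln N\<close>.\<close>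

lemma network_states_le:
  assumes "y \<in> network_states C N" "N \<ge> 1" "y C < 1"
  shows "1 / real N \<le> 1 - y C"
proof -
  obtain k where k: "real N * y C = real k"
    using network_statesD[OF assms(1)] by (auto elim: Nats_cases)
  have "real N * y C < real N" using assms by simp
  then have "k < N" using k by simp
  then have "real k + 1 \<le> real N" by linarith
  then show ?thesis using k assms by (simp add: field_simps)
qed

lemma finite_network_states:
  assumes "N \<ge> 1"
  shows "finite (network_states C N)"
proof (rule finite_subset)
  let ?B = "(\<lambda>k. real k / real N) ` {..N}"
  show "finite {y. \<forall>n. (n \<in> {..C} \<longrightarrow> y n \<in> ?B) \<and> (n \<notin> {..C} \<longrightarrow> y n = (0::real))}"
    by (intro finite_set_of_finite_funs) auto
  show "network_states C N \<subseteq> {y. \<forall>n. (n \<in> {..C} \<longrightarrow> y n \<in> ?B) \<and> (n \<notin> {..C} \<longrightarrow> y n = 0)}"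
  proof (clarsimp, intro conjI impI)
    fix y n assume y: "y \<in> network_states C N"
    show "y n = 0" if "\<not> n \<le> C" using network_statesD(1)[OF y] prob_vectorsD(2) that by auto
    obtain k where k: "real N * y n = real k"
      using network_statesD[OF y] by (auto elim: Nats_cases)
    have "real k \<le> real N * 1"
      unfolding k[symmetric] using prob_vectors_le_1[OF network_statesD(1)[OF y]]
      by (intro mult_left_mono) auto
    moreover have "y n = real k / real N" using k assms by (simp add: field_simps)
    ultimately show "y n \<in> ?B" by auto
  qed
qed

lemma unit_vector_0_in_states: "unit_vector 0 \<in> network_states C N"
  by (auto simp: network_states_def prob_vectors_def unit_vector_def)

text \<open>After scaling by \<open>N\<close>, a move changes coordinate \<open>m\<close> by 1 and
  \<open>n\<close> by -1 only. Different choices of \<open>\<phi>\<close> give the increments of the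
  mass, the mean and the entropy.\<close>

lemma sum_move:
  assumes "n \<le> C" "m \<le> C" "n \<noteq> m" "N \<ge> 1"
  shows "(\<Sum>i\<le>C. \<phi> i (real N * move N n m y i)) =
    (\<Sum>i\<le>C. \<phi> i (real N * y i)) + (\<phi> m (real N * y m + 1) - \<phi> m (real N * y m))
      + (\<phi> n (real N * y n - 1) - \<phi> n (real N * y n) :: real)"
proof -
  have split: "(\<Sum>i\<le>C. h i) = h m + (h n + (\<Sum>i\<in>{..C} - {m} - {n}. h i))" for h :: "nat \<Rightarrow> real"
    using assms by (simp add: sum.remove[of _ m] sum.remove[of _ n])
  have "(\<Sum>i\<in>{..C} - {m} - {n}. \<phi> i (real N * move N n m y i)) = (\<Sum>i\<in>{..C} - {m} - {n}. \<phi> i (real N * y i))"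
    by (intro sum.cong) (auto simp: move_def unit_vector_def)
  moreover have "real N * move N n m y m = real N * y m + 1" "real N * move N n m y n = real N * y n - 1"
    using assms by (auto simp: move_def unit_vector_def field_simps)
  ultimately show ?thesis unfolding split by simp
qed

lemma mean_move:
  assumes "n \<le> C" "m \<le> C" "n \<noteq> m" "N \<ge> 1"
  shows "mean C (move N n m y) = mean C y + (real m - real n) / real N"
proof -
  have "real N * mean C (move N n m y) = real N * mean C y + (real m - real n)"
    using sum_move[OF assms, of "\<lambda>i x. real i * x" y]
    by (simp add: mean_def sum_distrib_left algebra_simps)
  then show ?thesis using assms by (simp add: field_simps)
qed

lemma move_in_states:
  assumes "y \<in> network_states C N" "n \<le> C" "m \<le> C" "n \<noteq> m" "N \<ge> 1" "y n > 0"
  shows "move N n m y \<in> network_states C N"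
proof -
  note y = network_statesD[OF assms(1)]
  have val: "real N * move N n m y i \<in> \<nat>" for i
  proof (cases "i = n")
    case True
    obtain k where k: "real N * y n = real k" using y by (auto elim: Nats_cases)
    then have "real k \<ge> 1" using network_states_ge_1 assms by metis
    then have "real N * move N n m y i = real (k - 1)"
      using True k assms by (simp add: move_def unit_vector_def algebra_simps of_nat_diff)
    then show ?thesis by (metis of_nat_in_Nats)
  next
    case False
    then have "real N * move N n m y i = real N * y i + (if i = m then 1 else 0)"
      using assms by (simp add: move_def unit_vector_def algebra_simps)
    then show ?thesis using y(2)[of i] by (auto intro: Nats_add)
  qed
  have "0 \<le> move N n m y i" for i
  proof -
    obtain k where "real N * move N n m y i = real k" using val[of i] by (auto elim: Nats_cases)
    then have "0 \<le> real N * move N n m y i" by simp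
    then show ?thesis using assms(5) by (simp add: zero_le_mult_iff)
  qed
  moreover have "move N n m y i = 0" if "i > C" for i
    using that assms prob_vectorsD(2)[OF y(1) that] by (simp add: move_def unit_vector_def)
  moreover have "(\<Sum>i\<le>C. move N n m y i) = 1"
    using sum_move[OF assms(2-5), of "\<lambda>i x. x / real N" y] assms prob_vectorsD(3)[OF y(1)]
    by (simp add: diff_divide_distrib add_divide_distrib)
  ultimately show ?thesis using val by (simp add: network_states_def prob_vectors_def)
qed

section \<open>Rates, generator and irreducibility\<close>

definition arrival_rate :: "nat \<Rightarrow> real \<Rightarrow> (nat \<Rightarrow> real) \<Rightarrow> real" where
  "arrival_rate C lam y = (if y C < 1 then lam / (1 - y C) else 0)"

lemma arrival_rate_nonneg: "0 \<le> lam \<Longrightarrow> 0 \<le> arrival_rate C lam y"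
  by (simp add: arrival_rate_def)

lemma arrival_rate_sum:
  assumes "y \<in> prob_vectors C"
  shows "(\<Sum>n<C. arrival_rate C lam y * y n) = (if y C < 1 then lam else 0)"
  using prob_vectors_sum_lessThan[OF assms]
  by (simp add: arrival_rate_def flip: sum_distrib_left)

text \<open>Departures are reindexed by their target level, so that both sums run over the same
  pairs of neighbouring levels \<open>n\<close> and \<open>Suc n\<close>.\<close>

lemma network_rate_eq:
  "network_rate C lam N y y' =
     (\<Sum>n<C. if y' = move N n (Suc n) y then real N * arrival_rate C lam y * y n else 0) +
     (\<Sum>n<C. if y' = move N (Suc n) n y then real N * real (Suc n) * y (Suc n) else 0)"
proof -
  have "(\<Sum>n=1..C. if y' = move N n (n - 1) y then real N * real n * y n else 0)
      = (\<Sum>n<C. if y' = move N (Suc n) n y then real N * real (Suc n) * y (Suc n) else 0)"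
    by (rule sum.reindex_bij_witness[of _ Suc "\<lambda>n. n - 1"]) auto
  then show ?thesis
    unfolding network_rate_def arrival_rate_def by (auto intro!: sum.cong arg_cong2[of _ _ _ _ "(+)"])
qed

lemma network_rate_nonneg:
  assumes "y \<in> prob_vectors C" "0 \<le> lam"
  shows "0 \<le> network_rate C lam N y y'"
  unfolding network_rate_eq using prob_vectorsD(1)[OF assms(1)] assms(2) arrival_rate_nonneg
  by (intro add_nonneg_nonneg sum_nonneg) auto

text \<open>The sum over target states collapses onto the single moves. A move out of an empty level
  may leave the state space, but its rate is 0, so it contributes nothing on either side.\<close>

lemma network_generator:
  assumes "y \<in> network_states C N" "N \<ge> 1"
  shows "(\<Sum>y'\<in>network_states C N. network_rate C lam N y y' * (f y' - f y)) =
    real N * ((\<Sum>n<C. arrival_rate C lam y * y n * (f (move N n (Suc n) y) - f y)) +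
      (\<Sum>n<C. real (Suc n) * y (Suc n) * (f (move N (Suc n) n y) - f y)))"
proof -
  let ?S = "network_states C N"
  note fin = finite_network_states[OF assms(2), of C]
  have one: "(\<Sum>y'\<in>?S. \<Sum>n<C. (if y' = move N (s n) (t n) y then c n * y (s n) else 0) * (f y' - f y))
     = (\<Sum>n<C. c n * y (s n) * (f (move N (s n) (t n) y) - f y))"
    if st: "\<And>n. n < C \<Longrightarrow> s n \<le> C \<and> t n \<le> C \<and> s n \<noteq> t n" for s t :: "nat \<Rightarrow> nat" and c
  proof -
    have "(\<Sum>y'\<in>?S. (if y' = move N (s n) (t n) y then c n * y (s n) else 0) * (f y' - f y))
       = c n * y (s n) * (f (move N (s n) (t n) y) - f y)" if "n < C" for n
    proof (cases "y (s n) = 0")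
      case False
      then have "y (s n) > 0"
        using prob_vectorsD(1)[OF network_statesD(1)[OF assms(1)], of "s n"] by simp
      then have "move N (s n) (t n) y \<in> ?S"
        using move_in_states assms st that by blast
      then show ?thesis using fin by (simp add: if_distrib[of "\<lambda>x. x * _"] cong: if_cong)
    qed (simp add: if_distrib cong: if_cong)
    then show ?thesis by (subst sum.swap) (auto intro!: sum.cong)
  qed
  show ?thesis
    unfolding network_rate_eq distrib_right sum.distrib sum_distrib_right
    using one[of "\<lambda>n. n" Suc "\<lambda>n. real N * arrival_rate C lam y"]
      one[of Suc "\<lambda>n. n" "\<lambda>n. real N * real (Suc n)"]
    by (simp only: distrib_left[of "real N"] sum_distrib_left mult.assoc)
      (simp del: of_nat_Suc)
qed

text \<open>Each departure can be undone by an arrival, since the node just left is non-saturated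
  and so \<open>y' C < 1\<close>. Departures lower the number of customers
  \<open>N * mean C y\<close> one at a time down to the empty network \<open>unit_vector 0\<close>,
  which therefore communicates with every state.\<close>

lemma irreducible_network:
  assumes N: "N \<ge> 1" and lam: "0 < lam"
  shows "irreducible_jump (network_states C N) (network_rate C lam N)"
proof -
  let ?S = "network_states C N"
  let ?R = "{(u, v). u \<in> ?S \<and> v \<in> ?S \<and> u \<noteq> v \<and> network_rate C lam N u v > 0}"
  have edges: "(y, y') \<in> ?R \<and> (y', y) \<in> ?R"
    if y: "y \<in> ?S" and n: "n < C" "y (Suc n) > 0" and y': "y' = move N (Suc n) n y" for y y' n
  proof -
    have y'S: "y' \<in> ?S" unfolding y' using move_in_states[OF y, of "Suc n" n] n N by simp
    have pv: "0 \<le> y i" "0 \<le> y' i" for i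
      using y y'S network_statesD prob_vectorsD by blast+
    have rev: "y = move N n (Suc n) y'"
      unfolding y' by (auto simp: move_def fun_eq_iff unit_vector_def)
    have y'n: "y' n > 0" using pv(1)[of n] N by (simp add: y' move_def unit_vector_def add_nonneg_pos)
    then have "(\<Sum>i<C. y' i) > 0" using n pv by (intro sum_pos2[of _ n]) auto
    then have y'C: "y' C < 1"
      using prob_vectors_sum_lessThan[OF network_statesD(1)[OF y'S]] by simp
    have "y \<noteq> y'" using N by (auto simp: y' move_def fun_eq_iff unit_vector_def dest!: spec[of _ n])
    moreover have "network_rate C lam N y y' > 0"
      unfolding network_rate_eq using n N pv lam arrival_rate_nonneg[of lam C y]
      by (intro add_nonneg_pos sum_nonneg sum_pos2[of _ n]) (auto simp: y')
    moreover have "network_rate C lam N y' y > 0"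
      unfolding network_rate_eq using n N pv lam y'n y'C rev arrival_rate_nonneg[of lam C y']
      by (intro add_pos_nonneg sum_nonneg sum_pos2[of _ n]) (auto simp: arrival_rate_def)
    ultimately show ?thesis using y y'S by auto
  qed
  have root: "(y, unit_vector 0) \<in> ?R\<^sup>* \<and> (unit_vector 0, y) \<in> ?R\<^sup>*"
    if "y \<in> ?S" "real N * mean C y = real k" for y k
    using that
  proof (induction k arbitrary: y)
    case (0 y)
    then have "mean C y = 0" using N by simp
    then have "real (Suc n) * y (Suc n) = 0" if "n < C" for n
      using that prob_vectorsD(1)[OF network_statesD(1)[OF 0(1)]] sum_nonneg_eq_0_iff[of "{..<C}" "\<lambda>n. real (Suc n) * y (Suc n)"]
      unfolding mean_eq_sum_lessThan by auto
    then have "y n = 0" if "0 < n" "n \<le> C" for n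
      using that by (cases n) auto
    then have zero: "y n = 0" if "n \<noteq> 0" for n
      using that prob_vectorsD(2)[OF network_statesD(1)[OF 0(1)]] by (cases "n \<le> C") auto
    then have "y 0 = 1"
      using prob_vectorsD(3)[OF network_statesD(1)[OF 0(1)]] by (simp add: sum.remove[of _ 0])
    then have "y = unit_vector 0" using zero by (auto simp: unit_vector_def fun_eq_iff)
    then show ?case by simp
  next
    case (Suc k y)
    have "\<exists>n<C. y (Suc n) > 0"
    proof (rule ccontr)
      assume "\<not> ?thesis"
      then have "mean C y \<le> 0" unfolding mean_eq_sum_lessThan
        by (intro sum_nonpos mult_nonneg_nonpos) (simp, meson lessThan_iff not_less)
      then have "real N * mean C y \<le> 0" by (simp add: mult_nonneg_nonpos)
      then show False using Suc.prems by simp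
    qed
    then obtain n where n: "n < C" "y (Suc n) > 0" by blast
    define y' where "y' = move N (Suc n) n y"
    have e: "(y, y') \<in> ?R" "(y', y) \<in> ?R" using edges[OF Suc.prems(1) n y'_def] by auto
    have "real N * mean C y' = real k"
      using n N Suc.prems(2) by (simp add: y'_def mean_move distrib_left right_diff_distrib)
    then have "(y', unit_vector 0) \<in> ?R\<^sup>*" "(unit_vector 0, y') \<in> ?R\<^sup>*"
      using Suc.IH[of y'] e by auto
    then show ?case
      using converse_rtrancl_into_rtrancl[OF e(1)] rtrancl_into_rtrancl[OF _ e(2)] by blast
  qed
  have all: "(y, unit_vector 0) \<in> ?R\<^sup>* \<and> (unit_vector 0, y) \<in> ?R\<^sup>*" if y: "y \<in> ?S" for y
  proof -
    have "\<forall>n. \<exists>k. real N * y n = real k"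
      using network_statesD(2)[OF y] by (blast elim: Nats_cases)
    then obtain k where k: "\<And>n. real N * y n = real (k n)" by metis
    have "real N * mean C y = (\<Sum>n\<le>C. real n * (real N * y n))"
      by (simp add: mean_def sum_distrib_left mult_ac)
    also have "\<dots> = real (\<Sum>n\<le>C. n * k n)" by (simp add: k)
    finally show ?thesis by (rule root[OF y])
  qed
  show ?thesis unfolding irreducible_jump_def using all by (meson rtrancl_trans)
qed

lemma ex1_network_invariant:
  assumes "N \<ge> 1" "0 < lam"
  shows "\<exists>!p. invariant_distribution (network_states C N) (network_rate C lam N) p"
proof (rule ex1_invariant_distribution)
  show "network_states C N \<noteq> {}" using unit_vector_0_in_states by blast
  show "0 \<le> network_rate C lam N x y" if "x \<in> network_states C N" for x y
    using network_rate_nonneg network_statesD(1)[OF that] assms by simp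
qed (use assms finite_network_states irreducible_network in blast)+

section \<open>Mean and entropy under the invariant distribution\<close>

definition generator ::
    "nat \<Rightarrow> real \<Rightarrow> nat \<Rightarrow> ((nat \<Rightarrow> real) \<Rightarrow> real) \<Rightarrow> (nat \<Rightarrow> real) \<Rightarrow> real" where
  "generator C lam N f y =
    real N * ((\<Sum>n<C. arrival_rate C lam y * y n * (f (move N n (Suc n) y) - f y)) +
      (\<Sum>n<C. real (Suc n) * y (Suc n) * (f (move N (Suc n) n y) - f y)))"

lemma generator_expectation:
  assumes "N \<ge> 1" "invariant_distribution (network_states C N) (network_rate C lam N) p"
  shows "(\<Sum>y\<in>network_states C N. pmf p y * generator C lam N f y) = 0"
  using invariant_expectation_generator[OF finite_network_states[OF assms(1)] assms(2), of f]
  by (simp add: network_generator[OF _ assms(1)] generator_def)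

text \<open>The mean has drift \<open>lam - mean C y\<close>, and its jumps of size
  \<open>1 / N\<close> add a term of order \<open>1 / N\<close>. When \<open>y C = 1\<close> there
  are no arrivals, but then the mean is \<open>C > lam\<close>, so their absence only strengthens
  the pull towards \<open>lam\<close>.\<close>

lemma generator_mean_square:
  assumes y: "y \<in> network_states C N" and N: "N \<ge> 1" and lam: "0 < lam" "lam < real C"
  shows "generator C lam N (\<lambda>y. (mean C y - lam)\<^sup>2) y
    \<le> - 2 * (mean C y - lam)\<^sup>2 + (lam + real C) / real N"
proof -
  let ?m = "mean C y" and ?A = "if y C < 1 then lam else 0"
  note pv = network_statesD(1)[OF y]
  have up: "(mean C (move N n (Suc n) y) - lam)\<^sup>2 - (?m - lam)\<^sup>2 = 2 * (?m - lam) / real N + 1 / (real N)\<^sup>2"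
    if "n < C" for n
    using that N by (simp add: mean_move power2_eq_square field_simps)
  have down: "(mean C (move N (Suc n) n y) - lam)\<^sup>2 - (?m - lam)\<^sup>2 = - 2 * (?m - lam) / real N + 1 / (real N)\<^sup>2"
    if "n < C" for n
    using that N by (simp add: mean_move power2_eq_square field_simps)
  have "generator C lam N (\<lambda>y. (mean C y - lam)\<^sup>2) y = real N *
      (?A * (2 * (?m - lam) / real N + 1 / (real N)\<^sup>2) + ?m * (- 2 * (?m - lam) / real N + 1 / (real N)\<^sup>2))"
  proof -
    have "(\<Sum>n<C. arrival_rate C lam y * y n * ((mean C (move N n (Suc n) y) - lam)\<^sup>2 - (?m - lam)\<^sup>2))
        = ?A * (2 * (?m - lam) / real N + 1 / (real N)\<^sup>2)"
      unfolding arrival_rate_sum[OF pv, of lam, symmetric] sum_distrib_right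
      by (intro sum.cong refl) (simp only: up lessThan_iff)
    moreover have "(\<Sum>n<C. real (Suc n) * y (Suc n) * ((mean C (move N (Suc n) n y) - lam)\<^sup>2 - (?m - lam)\<^sup>2))
        = (\<Sum>n<C. real (Suc n) * y (Suc n)) * (- 2 * (?m - lam) / real N + 1 / (real N)\<^sup>2)"
      unfolding sum_distrib_right by (intro sum.cong refl) (simp only: down lessThan_iff)
    ultimately show ?thesis
      unfolding generator_def by (simp only: mean_eq_sum_lessThan[of C y, symmetric])
  qed
  also have "\<dots> = 2 * (?m - lam) * (?A - ?m) + (?A + ?m) / real N"
    using N by (simp add: field_simps power2_eq_square)
  also have "\<dots> \<le> - 2 * (?m - lam)\<^sup>2 + (lam + real C) / real N"
  proof (rule add_mono)
    show "2 * (?m - lam) * (?A - ?m) \<le> - 2 * (?m - lam)\<^sup>2"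
    proof (cases "y C < 1")
      case True
      then show ?thesis by (simp add: power2_eq_square algebra_simps)
    next
      case False
      then have "y C = 1" using prob_vectors_le_1[OF pv, of C] by simp
      then have "?m = real C" using mean_bounds[OF pv] by simp
      then have "0 \<le> lam * (?m - lam)" using lam by simp
      then show ?thesis using False by (simp add: power2_eq_square algebra_simps)
    qed
    show "(?A + ?m) / real N \<le> (lam + real C) / real N"
      using mean_bounds[OF pv] lam by (intro divide_right_mono) auto
  qed
  finally show ?thesis .
qed

lemma invariant_mean_square:
  assumes N: "N \<ge> 1" and lam: "0 < lam" "lam < real C"
    and inv: "invariant_distribution (network_states C N) (network_rate C lam N) p"
  shows "(\<Sum>y\<in>network_states C N. pmf p y * (mean C y - lam)\<^sup>2) \<le> (lam + real C) / (2 * real N)"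
proof -
  let ?S = "network_states C N"
  have one: "(\<Sum>y\<in>?S. pmf p y) = 1"
    using sum_pmf_eq_1[OF finite_network_states[OF N]] inv by (simp add: invariant_distribution_def)
  have "0 \<le> (\<Sum>y\<in>?S. pmf p y * (- 2 * (mean C y - lam)\<^sup>2 + (lam + real C) / real N))"
    unfolding generator_expectation[OF N inv, of "\<lambda>y. (mean C y - lam)\<^sup>2", symmetric]
    by (intro sum_mono mult_left_mono generator_mean_square N lam) auto
  also have "\<dots> = - 2 * (\<Sum>y\<in>?S. pmf p y * (mean C y - lam)\<^sup>2) + (\<Sum>y\<in>?S. pmf p y) * ((lam + real C) / real N)"
  proof -
    have "(\<Sum>y\<in>?S. pmf p y * (- 2 * g y + K)) = - 2 * (\<Sum>y\<in>?S. pmf p y * g y) + (\<Sum>y\<in>?S. pmf p y) * K"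
      for g and K :: real
      by (simp add: algebra_simps sum.distrib sum_negf sum_subtractf sum_distrib_left sum_distrib_right)
    then show ?thesis .
  qed
  finally show ?thesis unfolding one by (simp add: field_simps)
qed

section \<open>Entropy production along the jumps\<close>

text \<open>This is \<open>ln x \<le> x - 1\<close> at \<open>x = sqrt (b / a)\<close>. Added to the
  same bound with \<open>a\<close> and \<open>b\<close> exchanged, it gives
  \<open>- 2 * (sqrt a - sqrt b)\<^sup>2\<close>.\<close>

lemma mult_ln_le_sqrt:
  fixes a b :: real
  assumes "0 \<le> a" "0 < b"
  shows "a * ln (b / a) \<le> 2 * sqrt (a * b) - 2 * a"
proof (cases "a = 0")
  case False
  then have a: "a > 0" using assms by simp
  have "ln (b / a) = 2 * ln (sqrt (b / a))" using a assms by (simp add: ln_sqrt)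
  also have "\<dots> \<le> 2 * (sqrt (b / a) - 1)" using a assms by (intro mult_left_mono ln_le_minus_one) auto
  finally have "a * ln (b / a) \<le> a * (2 * (sqrt (b / a) - 1))" using a by (intro mult_left_mono) auto
  also have "\<dots> = 2 * (a * sqrt (b / a)) - 2 * a" by (simp add: algebra_simps)
  also have "a * sqrt (b / a) = sqrt (a * b)"
    using a by (simp add: real_sqrt_mult real_sqrt_divide real_div_sqrt)
      (metis less_imp_le mult.assoc mult.commute real_div_sqrt times_divide_eq_left)
  finally show ?thesis .
qed simp

text \<open>The exchange between levels \<open>n\<close> and \<open>Suc n\<close>, with
  \<open>x = y n\<close>, \<open>z = y (Suc n)\<close>, \<open>c = Suc n\<close> and
  \<open>M = N\<close>. Splitting off \<open>ln u\<close> leaves logarithms of ratios of the fluxes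
  \<open>u * x\<close> and \<open>c * z\<close>. The discrete \<open>+ 1\<close> perturbs a flux by
  \<open>c / M\<close> or \<open>u / M\<close>, which subadditivity of the square root moves into
  the error terms.\<close>

lemma entropy_flux_le:
  fixes u x z c M :: real
  assumes "0 < u" "0 \<le> x" "0 \<le> z" "0 < c" "0 < M"
  shows "u * x * ln (c * (M * z + 1) / (M * x)) + c * z * ln ((M * x + 1) / (c * (M * z)))
    \<le> - 2 * (sqrt (u * x) - sqrt (c * z))\<^sup>2 + ln u * (u * x - c * z)
      + 2 * sqrt (u * x * c / M) + 2 * sqrt (c * z * u / M)"
proof -
  let ?a = "u * x" and ?b = "c * z"
  have ab: "0 \<le> ?a" "0 \<le> ?b" "0 < ?b + c / M" "0 < ?a + u / M" using assms by (auto intro: add_nonneg_pos)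
  have 1: "?a * ln (c * (M * z + 1) / (M * x)) = ?a * ln u + ?a * ln ((?b + c / M) / ?a)"
  proof (cases "x = 0")
    case False
    then have "c * (M * z + 1) / (M * x) = u * ((?b + c / M) / ?a)" using assms by (simp add: field_simps)
    moreover have "ln (u * ((?b + c / M) / ?a)) = ln u + ln ((?b + c / M) / ?a)"
      using False ab assms by (intro ln_mult_pos divide_pos_pos) auto
    ultimately show ?thesis by (simp add: distrib_left)
  qed simp
  have 2: "?b * ln ((M * x + 1) / (c * (M * z))) = - (?b * ln u) + ?b * ln ((?a + u / M) / ?b)"
  proof (cases "z = 0")
    case False
    then have "(M * x + 1) / (c * (M * z)) = (?a + u / M) / ?b / u" using assms by (simp add: field_simps)
    moreover have "ln ((?a + u / M) / ?b / u) = ln ((?a + u / M) / ?b) - ln u"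
      using False ab assms by (intro ln_divide_pos divide_pos_pos) auto
    ultimately show ?thesis by (simp add: right_diff_distrib)
  qed simp
  have *: "A \<le> 2 * s - 2 * a \<Longrightarrow> s \<le> t \<Longrightarrow> A \<le> 2 * t - 2 * a" for A s t a :: real by simp
  have 3: "?a * ln ((?b + c / M) / ?a) \<le> 2 * (sqrt (?a * ?b) + sqrt (?a * c / M)) - 2 * ?a"
  proof -
    have "sqrt (?a * (?b + c / M)) \<le> sqrt (?a * ?b) + sqrt (?a * c / M)"
      unfolding distrib_left using sqrt_add_le_add_sqrt[of "?a * ?b" "?a * (c / M)"] ab assms by simp
    then show ?thesis by (rule *[OF mult_ln_le_sqrt[OF ab(1,3)]])
  qed
  have 4: "?b * ln ((?a + u / M) / ?b) \<le> 2 * (sqrt (?a * ?b) + sqrt (?b * u / M)) - 2 * ?b"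
  proof -
    have "sqrt (?b * (?a + u / M)) \<le> sqrt (?a * ?b) + sqrt (?b * u / M)"
      unfolding distrib_left using sqrt_add_le_add_sqrt[of "?b * ?a" "?b * (u / M)"] ab assms
      by (simp add: mult.commute)
    then show ?thesis by (rule *[OF mult_ln_le_sqrt[OF ab(2,4)]])
  qed
  have "(sqrt ?a - sqrt ?b)\<^sup>2 = ?a + ?b - 2 * sqrt (?a * ?b)"
    using ab by (simp add: power2_diff real_sqrt_mult[of ?a ?b])
  then show ?thesis using 1 2 3 4 by (simp add: algebra_simps)
qed

text \<open>With \<open>ln\<close> of factorials instead of \<open>x ln x\<close>, the increments along the moves are exact
  logarithms, also at the boundary of the simplex.\<close>

definition entropy :: "nat \<Rightarrow> nat \<Rightarrow> (nat \<Rightarrow> real) \<Rightarrow> real" where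
  "entropy C N y =
    (\<Sum>n\<le>C. ln (fact (nat \<lfloor>real N * y n\<rfloor>)) + real N * y n * ln (fact n)) / real N"

lemma entropy_move:
  assumes y: "y \<in> network_states C N" and nm: "n \<le> C" "m \<le> C" "n \<noteq> m" and N: "N \<ge> 1" and yn: "y n > 0"
  shows "real N * (entropy C N (move N n m y) - entropy C N y)
    = ln (real N * y m + 1) - ln (real N * y n) + ln (fact m) - ln (fact n)"
proof -
  define \<phi> where "\<phi> i x = ln (fact (nat \<lfloor>x\<rfloor>)) + x * ln (fact i)" for i :: nat and x :: real
  have step: "\<phi> i (real k + 1) - \<phi> i (real k) = ln (real k + 1) + ln (fact i)" for i k
  proof -
    have "nat \<lfloor>real k + 1\<rfloor> = Suc k" by linarith
    then have "ln (fact (nat \<lfloor>real k + 1\<rfloor>)) = ln (real k + 1) + ln (fact k :: real)"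
      by (simp add: ln_mult_pos add.commute)
    then show ?thesis by (simp add: \<phi>_def algebra_simps)
  qed
  obtain k where k: "real N * y m = real k"
    using network_statesD(2)[OF y] by (auto elim: Nats_cases)
  obtain j where j: "real N * y n = real j"
    using network_statesD(2)[OF y] by (auto elim: Nats_cases)
  then have "real j \<ge> 1" using network_states_ge_1[OF y N yn] by simp
  \<comment> \<open>Writing the positive integer \<open>N * y n\<close> as a successor makes the
    removal at \<open>n\<close> the reverse of an addition, so \<open>step\<close> covers
    both.\<close>
  then obtain j' where j': "real N * y n = real j' + 1"
    using j by (cases j) auto
  have "real N * (entropy C N (move N n m y) - entropy C N y)
      = (\<Sum>i\<le>C. \<phi> i (real N * move N n m y i)) - (\<Sum>i\<le>C. \<phi> i (real N * y i))"
    using N by (simp add: entropy_def \<phi>_def field_simps)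
  also have "\<dots> = (\<phi> m (real k + 1) - \<phi> m (real k)) - (\<phi> n (real j' + 1) - \<phi> n (real j'))"
    unfolding sum_move[OF nm N] k j' by simp
  also have "\<dots> = ln (real N * y m + 1) - ln (real N * y n) + ln (fact m) - ln (fact n)"
    unfolding step k j' by simp
  finally show ?thesis .
qed

text \<open>The factor \<open>N\<close> of the rates cancels the \<open>1 / N\<close> in the
  entropy, so the logarithms of \<open>entropy_move\<close> enter unscaled. At an empty level, where
  \<open>entropy_move\<close> does not apply, the prefactor makes both sides 0.\<close>

lemma generator_entropy:
  assumes y: "y \<in> network_states C N" and N: "N \<ge> 1"
  shows "generator C lam N (entropy C N) y =
    (\<Sum>n<C. arrival_rate C lam y * y n * ln (real (Suc n) * (real N * y (Suc n) + 1) / (real N * y n))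
      + real (Suc n) * y (Suc n) * ln ((real N * y n + 1) / (real (Suc n) * (real N * y (Suc n)))))"
proof -
  note nn = prob_vectorsD(1)[OF network_statesD(1)[OF y]]
  have fs: "ln (fact (Suc n) :: real) = ln (real (Suc n)) + ln (fact n)" for n
    by (simp add: ln_mult_pos del: of_nat_Suc)
  have up: "y n * (real N * (entropy C N (move N n (Suc n) y) - entropy C N y))
      = y n * ln (real (Suc n) * (real N * y (Suc n) + 1) / (real N * y n))" if n: "n < C" for n
  proof (cases "y n = 0")
    case False
    then have yn: "y n > 0" using nn[of n] by simp
    have pos: "0 < real N * y (Suc n) + 1" using nn[of "Suc n"] by (simp add: add_nonneg_pos)
    have "real N * (entropy C N (move N n (Suc n) y) - entropy C N y)
      = ln (real N * y (Suc n) + 1) - ln (real N * y n) + ln (real (Suc n))"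
      using entropy_move[OF y _ _ _ N yn, of "Suc n"] n fs[of n] by simp
    also have "\<dots> = ln (real (Suc n) * (real N * y (Suc n) + 1) / (real N * y n))"
      using pos yn N by (simp add: ln_mult_pos ln_divide_pos del: of_nat_Suc)
    finally show ?thesis by simp
  qed simp
  have down: "y (Suc n) * (real N * (entropy C N (move N (Suc n) n y) - entropy C N y))
      = y (Suc n) * ln ((real N * y n + 1) / (real (Suc n) * (real N * y (Suc n))))" if n: "n < C" for n
  proof (cases "y (Suc n) = 0")
    case False
    then have yn: "y (Suc n) > 0" using nn[of "Suc n"] by simp
    have pos: "0 < real N * y n + 1" using nn[of "n"] by (simp add: add_nonneg_pos)
    have "real N * (entropy C N (move N (Suc n) n y) - entropy C N y)
      = ln (real N * y n + 1) - ln (real N * y (Suc n)) - ln (real (Suc n))"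
      using entropy_move[OF y _ _ _ N yn, of n] n fs[of n] by simp
    also have "\<dots> = ln ((real N * y n + 1) / (real (Suc n) * (real N * y (Suc n))))"
      using pos yn N by (simp add: ln_mult_pos ln_divide_pos del: of_nat_Suc)
    finally show ?thesis by simp
  qed simp
  have "generator C lam N (entropy C N) y =
    (\<Sum>n<C. arrival_rate C lam y * (y n * (real N * (entropy C N (move N n (Suc n) y) - entropy C N y))))
    + (\<Sum>n<C. real (Suc n) * (y (Suc n) * (real N * (entropy C N (move N (Suc n) n y) - entropy C N y))))"
    by (simp only: generator_def distrib_left[of "real N"] sum_distrib_left mult_ac)
  also have "\<dots> =
    (\<Sum>n<C. arrival_rate C lam y * (y n * ln (real (Suc n) * (real N * y (Suc n) + 1) / (real N * y n))))
    + (\<Sum>n<C. real (Suc n) * (y (Suc n) * ln ((real N * y n + 1) / (real (Suc n) * (real N * y (Suc n))))))"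
    by (intro arg_cong2[of _ _ _ _ "(+)"] sum.cong refl) (simp_all only: up down lessThan_iff)
  finally show ?thesis by (simp only: sum.distrib mult.assoc)
qed

text \<open>The factor \<open>1 - y\<^sub>C\<close>, which clears the denominator of the arrival rate, makes this continuous
  on the whole simplex.\<close>

definition dissipation :: "nat \<Rightarrow> real \<Rightarrow> (nat \<Rightarrow> real) \<Rightarrow> real" where
  "dissipation C lam y =
    (\<Sum>n<C. (sqrt (lam * y n) - sqrt ((1 - y C) * (real (Suc n) * y (Suc n))))\<^sup>2)"

text \<open>As \<open>lam\<close> is \<open>1 - y C\<close> times the arrival rate, each square on
  the left is \<open>1 - y C \<le> 1\<close> times the one on the right.\<close>

lemma dissipation_le:
  assumes y: "y \<in> prob_vectors C" and yC: "y C < 1" and lam: "0 < lam"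
  shows "dissipation C lam y \<le>
    (\<Sum>n<C. (sqrt (arrival_rate C lam y * y n) - sqrt (real (Suc n) * y (Suc n)))\<^sup>2)"
  unfolding dissipation_def
proof (rule sum_mono)
  fix n
  let ?d = "1 - y C"
  have d: "0 < ?d" "?d \<le> 1" using yC prob_vectorsD(1)[OF y, of C] by auto
  have "lam * y n = ?d * (arrival_rate C lam y * y n)" using d by (simp add: arrival_rate_def)
  then have "(sqrt (lam * y n) - sqrt (?d * (real (Suc n) * y (Suc n))))\<^sup>2
     = ?d * (sqrt (arrival_rate C lam y * y n) - sqrt (real (Suc n) * y (Suc n)))\<^sup>2"
    using d by (simp only: real_sqrt_mult[of ?d] right_diff_distrib[symmetric] power_mult_distrib) simp
  also have "\<dots> \<le> (sqrt (arrival_rate C lam y * y n) - sqrt (real (Suc n) * y (Suc n)))\<^sup>2"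
    using d by (intro mult_left_le_one_le) auto
  finally show "(sqrt (lam * y n) - sqrt (?d * (real (Suc n) * y (Suc n))))\<^sup>2 \<le> \<dots>" .
qed

text \<open>Summing \<open>entropy_flux_le\<close> over the levels, the coefficient of
  \<open>ln u\<close> becomes the net flux \<open>lam - mean C y\<close>, while
  \<open>1 / N \<le> 1 - y C \<le> 1\<close> bounds \<open>ln u\<close>. The saturated state is
  treated apart: it has only departures, and these do not increase the entropy.\<close>

lemma generator_entropy_le:
  assumes y: "y \<in> network_states C N" and N: "N \<ge> 1" and lam: "0 < lam" "lam < real C"
  shows "generator C lam N (entropy C N) y \<le> - 2 * dissipation C lam y
    + (\<bar>ln lam\<bar> + ln (real N)) * \<bar>lam - mean C y\<bar>
    + real C * (2 * sqrt (lam * real C / real N))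
    + real C * (2 * sqrt (real C * arrival_rate C lam y / real N))"
proof (cases "y C < 1")
  case True
  note pv = network_statesD(1)[OF y]
  note nn = prob_vectorsD(1)[OF pv]
  let ?u = "arrival_rate C lam y"
  have u: "?u > 0" using True lam by (simp add: arrival_rate_def)
  have lnu: "\<bar>ln ?u\<bar> \<le> \<bar>ln lam\<bar> + ln (real N)"
  proof -
    have d: "0 < 1 - y C" "1 - y C \<le> 1" "1 / real N \<le> 1 - y C"
      using True nn[of C] network_states_le[OF y N True] by auto
    have "ln (1 / real N) \<le> ln (1 - y C)" using d N by (subst ln_le_cancel_iff) auto
    then have "- ln (real N) \<le> ln (1 - y C)" using N by (simp add: ln_div)
    moreover have "ln (1 - y C) \<le> 0" using d by simp
    moreover have "ln ?u = ln lam - ln (1 - y C)" using True lam by (simp add: arrival_rate_def ln_divide_pos)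
    ultimately show ?thesis by linarith
  qed
  have un: "?u * y n \<le> lam" if "n < C" for n
  proof -
    have "?u * y n \<le> (\<Sum>n<C. ?u * y n)" using that u nn by (intro member_le_sum) auto
    then show ?thesis using arrival_rate_sum[OF pv, of lam] True by simp
  qed
  have cz: "real (Suc n) * y (Suc n) \<le> real C" if "n < C" for n
    using mult_mono[of "real (Suc n)" "real C" "y (Suc n)" 1] that nn prob_vectors_le_1[OF pv] by simp
  have "generator C lam N (entropy C N) y \<le>
    (\<Sum>n<C. - 2 * (sqrt (?u * y n) - sqrt (real (Suc n) * y (Suc n)))\<^sup>2
      + ln ?u * (?u * y n - real (Suc n) * y (Suc n))
      + 2 * sqrt (lam * real C / real N) + 2 * sqrt (real C * ?u / real N))"
    unfolding generator_entropy[OF y N]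
  proof (rule sum_mono)
    fix n assume "n \<in> {..<C}"
    then have n: "n < C" by simp
    have "?u * y n * real (Suc n) / real N \<le> lam * real C / real N"
      using un[OF n] n lam N u nn by (intro divide_right_mono mult_mono) auto
    moreover have "real (Suc n) * y (Suc n) * ?u / real N \<le> real C * ?u / real N"
      using cz[OF n] u by (intro divide_right_mono mult_right_mono) auto
    ultimately show "?u * y n * ln (real (Suc n) * (real N * y (Suc n) + 1) / (real N * y n))
      + real (Suc n) * y (Suc n) * ln ((real N * y n + 1) / (real (Suc n) * (real N * y (Suc n))))
      \<le> - 2 * (sqrt (?u * y n) - sqrt (real (Suc n) * y (Suc n)))\<^sup>2
      + ln ?u * (?u * y n - real (Suc n) * y (Suc n))
      + 2 * sqrt (lam * real C / real N) + 2 * sqrt (real C * ?u / real N)"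
      using entropy_flux_le[of ?u "y n" "y (Suc n)" "real (Suc n)" "real N"] u nn N
        real_sqrt_le_mono[of "?u * y n * real (Suc n) / real N" "lam * real C / real N"]
        real_sqrt_le_mono[of "real (Suc n) * y (Suc n) * ?u / real N" "real C * ?u / real N"]
      by (simp del: of_nat_Suc real_sqrt_le_iff)
  qed
  also have "\<dots> = - 2 * (\<Sum>n<C. (sqrt (?u * y n) - sqrt (real (Suc n) * y (Suc n)))\<^sup>2)
      + ln ?u * ((\<Sum>n<C. ?u * y n) - mean C y)
      + real C * (2 * sqrt (lam * real C / real N)) + real C * (2 * sqrt (real C * ?u / real N))"
  proof -
    have "(\<Sum>n<C. - 2 * a n + l * (b n - c n) + e + e')
        = - 2 * (\<Sum>n<C. a n) + l * ((\<Sum>n<C. b n) - (\<Sum>n<C. c n)) + real C * e + real C * e'"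
      for a b c :: "nat \<Rightarrow> real" and l e e' :: real
      by (simp add: sum.distrib sum_distrib_left sum_subtractf sum_negf right_diff_distrib)
    then show ?thesis unfolding mean_eq_sum_lessThan .
  qed
  also have "\<dots> \<le> - 2 * dissipation C lam y + (\<bar>ln lam\<bar> + ln (real N)) * \<bar>lam - mean C y\<bar>
      + real C * (2 * sqrt (lam * real C / real N)) + real C * (2 * sqrt (real C * ?u / real N))"
  proof -
    have "ln ?u * (lam - mean C y) \<le> \<bar>ln ?u\<bar> * \<bar>lam - mean C y\<bar>" by (metis abs_ge_self abs_mult)
    also have "\<dots> \<le> (\<bar>ln lam\<bar> + ln (real N)) * \<bar>lam - mean C y\<bar>" using lnu by (intro mult_right_mono) auto
    finally show ?thesis
      using dissipation_le[OF pv True lam(1)] arrival_rate_sum[OF pv, of lam] True by simp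
  qed
  finally show ?thesis .
next
  case False
  note pv = network_statesD(1)[OF y]
  note nn = prob_vectorsD(1)[OF pv]
  have yC: "y C = 1" using prob_vectors_le_1[OF pv, of C] False by simp
  then have "(\<Sum>n<C. y n) = 0" using prob_vectors_sum_lessThan[OF pv] by simp
  then have y0: "y n = 0" if "n < C" for n
    using that nn sum_nonneg_eq_0_iff[of "{..<C}" y] by simp
  have "generator C lam N (entropy C N) y \<le> (\<Sum>n<C. 0)"
    unfolding generator_entropy[OF y N]
  proof (rule sum_mono)
    fix n assume "n \<in> {..<C}"
    then have n: "n < C" by simp
    have "real (Suc n) * y (Suc n) * ln ((real N * y n + 1) / (real (Suc n) * (real N * y (Suc n)))) \<le> 0"
    proof (cases "y (Suc n) = 0")
      case False
      then have "y (Suc n) > 0" using nn[of "Suc n"] by simp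
      then have "1 * 1 \<le> real (Suc n) * (real N * y (Suc n))"
        using network_states_ge_1[OF y N] by (intro mult_mono) auto
      then have "ln (1 / (real (Suc n) * (real N * y (Suc n)))) \<le> 0"
        by (subst ln_le_zero_iff) (auto simp: divide_simps simp del: of_nat_Suc)
      then show ?thesis using nn[of "Suc n"] y0[OF n] by (intro mult_nonneg_nonpos) auto
    qed simp
    then show "arrival_rate C lam y * y n * ln (real (Suc n) * (real N * y (Suc n) + 1) / (real N * y n))
      + real (Suc n) * y (Suc n) * ln ((real N * y n + 1) / (real (Suc n) * (real N * y (Suc n)))) \<le> 0"
      using y0[OF n] by simp
  qed
  moreover have "dissipation C lam y = 0"
    using y0 yC by (simp add: dissipation_def)
  moreover have "0 \<le> (\<bar>ln lam\<bar> + ln (real N)) * \<bar>lam - mean C y\<bar>" using N by simp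
  moreover have "0 \<le> real C * (2 * sqrt (lam * real C / real N))" using lam by simp
  moreover have "0 \<le> real C * (2 * sqrt (real C * arrival_rate C lam y / real N))"
    using arrival_rate_nonneg lam by simp
  ultimately show ?thesis by simp
qed

text \<open>The cases are split at the midpoint of \<open>lam\<close> and \<open>C\<close>. If the
  mean is below it, \<open>C * y C \<le> mean C y\<close> keeps \<open>y C\<close> away from 1 and
  the arrival rate is bounded. Otherwise \<open>(mean C y - lam)\<^sup>2\<close> is bounded below
  and absorbs the crude bound \<open>lam * N\<close> on the rate.\<close>

lemma sqrt_arrival_rate_le:
  assumes y: "y \<in> network_states C N" and N: "N \<ge> 1" and lam: "0 < lam" "lam < real C"
  shows "sqrt (real C * arrival_rate C lam y / real N) \<le>
    sqrt (2 * real C * real C * lam / (real C - lam)) / sqrt (real N)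
      + 4 * sqrt (real C * lam) / (real C - lam)\<^sup>2 * (mean C y - lam)\<^sup>2"
proof -
  note pv = network_statesD(1)[OF y]
  let ?u = "arrival_rate C lam y" and ?m = "mean C y"
  have C: "0 < real C" "0 < real C - lam" using lam by auto
  consider "\<not> y C < 1" | "y C < 1" "?m \<le> (lam + real C) / 2" | "y C < 1" "?m > (lam + real C) / 2" by linarith
  then show ?thesis
  proof cases
    case 1
    then show ?thesis using lam by (simp add: arrival_rate_def)
  next
    case 2
    have "real C * y C \<le> (lam + real C) / 2" using mean_bounds(2)[OF pv] 2 by linarith
    then have "(real C - lam) / (2 * real C) \<le> 1 - y C" using C by (simp add: field_simps)
    then have "lam / (1 - y C) \<le> lam / ((real C - lam) / (2 * real C))"
      using 2 lam C by (intro divide_left_mono mult_pos_pos divide_pos_pos) auto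
    then have "?u \<le> lam / ((real C - lam) / (2 * real C))"
      using 2 by (simp only: arrival_rate_def if_True)
    then have "real C * ?u / real N \<le> real C * (lam / ((real C - lam) / (2 * real C))) / real N"
      by (intro divide_right_mono mult_left_mono) auto
    also have "\<dots> = 2 * real C * real C * lam / (real C - lam) / real N" by simp
    finally have "sqrt (real C * ?u / real N) \<le> sqrt (2 * real C * real C * lam / (real C - lam)) / sqrt (real N)"
      unfolding real_sqrt_divide[symmetric] by (rule real_sqrt_le_mono)
    moreover have "0 \<le> 4 * sqrt (real C * lam) / (real C - lam)\<^sup>2 * (?m - lam)\<^sup>2" using lam by simp
    ultimately show ?thesis by linarith
  next
    case 3
    have "((real C - lam) / 2)\<^sup>2 \<le> (?m - lam)\<^sup>2"
      using 3 C by (intro power_mono) (auto simp: field_simps)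
    then have one: "1 \<le> 4 / (real C - lam)\<^sup>2 * (?m - lam)\<^sup>2" using C by (simp add: field_simps)
    have "?u = lam / (1 - y C)" using 3 by (simp add: arrival_rate_def)
    also have "\<dots> \<le> lam / (1 / real N)"
      using network_states_le[OF y N 3(1)] lam N 3(1) by (intro divide_left_mono) auto
    finally have "real C * ?u / real N \<le> real C * lam" using N C by (simp add: field_simps)
    then have "sqrt (real C * ?u / real N) \<le> sqrt (real C * lam) * 1" by simp
    also have "\<dots> \<le> sqrt (real C * lam) * (4 / (real C - lam)\<^sup>2 * (?m - lam)\<^sup>2)"
      using one lam by (intro mult_left_mono) auto
    finally have "sqrt (real C * ?u / real N) \<le> 4 * sqrt (real C * lam) / (real C - lam)\<^sup>2 * (?m - lam)\<^sup>2"
      by (simp add: mult_ac)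
    moreover have "0 \<le> sqrt (2 * real C * real C * lam / (real C - lam)) / sqrt (real N)" using lam by simp
    ultimately show ?thesis by linarith
  qed
qed

text \<open>The generator of the entropy has expectation 0, so its upper bound has nonnegative
  expectation. The errors reduce to the constant \<open>a\<close> and to \<open>b\<close> times the
  squared deviation of the mean, which is controlled by
  \<open>invariant_mean_square\<close>.\<close>

lemma invariant_dissipation_le:
  assumes N: "N \<ge> 1" and lam: "0 < lam" "lam < real C"
    and inv: "invariant_distribution (network_states C N) (network_rate C lam N) p"
  shows "2 * (\<Sum>y\<in>network_states C N. pmf p y * dissipation C lam y) \<le>
    (\<bar>ln lam\<bar> + ln (real N)) * ((1 + (lam + real C) / 2) / sqrt (real N))
      + 2 * real C * (sqrt (lam * real C) + sqrt (2 * real C * real C * lam / (real C - lam))) / sqrt (real N)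
      + 8 * real C * sqrt (real C * lam) / (real C - lam)\<^sup>2 * ((lam + real C) / (2 * real N))"
proof -
  let ?S = "network_states C N" and ?r = "sqrt (real N)" and ?L = "\<bar>ln lam\<bar> + ln (real N)"
  define K1 where "K1 = sqrt (2 * real C * real C * lam / (real C - lam))"
  define K2 where "K2 = 4 * sqrt (real C * lam) / (real C - lam)\<^sup>2"
  define V where "V = (\<Sum>y\<in>?S. pmf p y * (mean C y - lam)\<^sup>2)"
  define E where "E = (\<Sum>y\<in>?S. pmf p y * dissipation C lam y)"
  define a where "a = ?L / ?r + 2 * real C * (sqrt (lam * real C) + K1) / ?r"
  define b where "b = ?L * ?r + 2 * real C * K2"
  have r: "?r > 0" "?r * ?r = real N" using N by auto
  have L: "?L \<ge> 0" using N by simp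
  have K2: "K2 \<ge> 0" using lam by (simp add: K2_def)
  have V: "V \<le> (lam + real C) / (2 * real N)" unfolding V_def by (rule invariant_mean_square[OF N lam inv])
  have one: "(\<Sum>y\<in>?S. pmf p y) = 1"
    using sum_pmf_eq_1[OF finite_network_states[OF N]] inv by (simp add: invariant_distribution_def)
  have pt: "generator C lam N (entropy C N) y \<le> - 2 * dissipation C lam y + a + b * (mean C y - lam)\<^sup>2"
    if y: "y \<in> ?S" for y
  proof -
    let ?t = "\<bar>lam - mean C y\<bar>"
    \<comment> \<open>The weight \<open>sqrt N\<close> balances the two terms: with a mean square of
      order \<open>1 / N\<close>, both have expectation of order \<open>1 / sqrt N\<close>.\<close>
    have "?t \<le> 1 / ?r + ?r * ?t\<^sup>2"
    proof (cases "?r * ?t \<le> 1")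
      case True
      then have "?t \<le> 1 / ?r" using r by (simp add: field_simps)
      then show ?thesis using r(1) by (intro add_increasing2) auto
    next
      case False
      then have "1 * ?t \<le> (?r * ?t) * ?t" by (intro mult_right_mono) auto
      then show ?thesis using r(1) by (intro add_increasing) (auto simp: power2_eq_square mult.assoc)
    qed
    also have "?t\<^sup>2 = (mean C y - lam)\<^sup>2" by (simp add: power2_commute)
    finally have "?L * ?t \<le> ?L * (1 / ?r + ?r * (mean C y - lam)\<^sup>2)" using L by (rule mult_left_mono)
    moreover have "real C * (2 * sqrt (real C * arrival_rate C lam y / real N))
      \<le> real C * (2 * (K1 / ?r + K2 * (mean C y - lam)\<^sup>2))"
      using sqrt_arrival_rate_le[OF y N lam] unfolding K1_def K2_def by (intro mult_left_mono) auto
    moreover have "real C * (2 * sqrt (lam * real C / real N)) = 2 * real C * sqrt (lam * real C) / ?r"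
      by (simp add: real_sqrt_divide)
    moreover have "?L * (1 / ?r + ?r * q) + 2 * real C * sqrt (lam * real C) / ?r + real C * (2 * (K1 / ?r + K2 * q)) = a + b * q"
      for q by (simp add: a_def b_def algebra_simps add_divide_distrib)
    ultimately show ?thesis using generator_entropy_le[OF y N lam] by smt
  qed
  have "0 \<le> (\<Sum>y\<in>?S. pmf p y * (- 2 * dissipation C lam y + a + b * (mean C y - lam)\<^sup>2))"
    unfolding generator_expectation[OF N inv, of "entropy C N", symmetric]
    by (intro sum_mono mult_left_mono pt) auto
  also have "\<dots> = - 2 * E + (\<Sum>y\<in>?S. pmf p y) * a + b * V"
  proof -
    have "(\<Sum>y\<in>?S. pmf p y * (- 2 * g y + a + b * h y))
        = - 2 * (\<Sum>y\<in>?S. pmf p y * g y) + (\<Sum>y\<in>?S. pmf p y) * a + b * (\<Sum>y\<in>?S. pmf p y * h y)" for g h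
      by (simp add: algebra_simps sum.distrib sum_negf sum_subtractf sum_distrib_left sum_distrib_right)
    then show ?thesis unfolding E_def V_def .
  qed
  finally have "2 * E \<le> a + b * V" using one by simp
  also have "b * V \<le> b * ((lam + real C) / (2 * real N))"
    using V L K2 r by (intro mult_left_mono) (auto simp: b_def)
  also have "a + b * ((lam + real C) / (2 * real N)) =
    ?L * ((1 + (lam + real C) / 2) / ?r) + 2 * real C * (sqrt (lam * real C) + K1) / ?r
      + 2 * real C * K2 * ((lam + real C) / (2 * real N))"
  proof -
    have "?r * ((lam + real C) / (2 * real N)) = (lam + real C) / 2 / ?r"
    proof -
      have "s * (q / (2 * (s * s))) = q / 2 / s" if "s > 0" for s q :: real
        using that by (simp add: field_simps)
      from this[OF r(1)] show ?thesis unfolding r(2) .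
    qed
    then have "?L * ?r * ((lam + real C) / (2 * real N)) = ?L * ((lam + real C) / 2 / ?r)"
      by (simp only: mult.assoc)
    then show ?thesis unfolding a_def b_def by (simp add: distrib_left distrib_right add_divide_distrib)
  qed
  finally show ?thesis unfolding E_def K1_def K2_def by (simp add: mult_ac)
qed

text \<open>The shape of the bound in \<open>invariant_dissipation_le\<close>; its slowest term is
  of order \<open>ln N / sqrt N\<close>.\<close>

lemma tendsto_dissipation_bound:
  fixes A B D E F :: real
  shows "(\<lambda>N. (A + ln (real N)) * (B / sqrt (real N)) + D / sqrt (real N) + E * (F / (2 * real N))) \<longlonglongrightarrow> 0"
proof -
  have 1: "(\<lambda>N. 1 / sqrt (real N)) \<longlonglongrightarrow> 0" by real_asymp
  have 2: "(\<lambda>N. ln (real N) / sqrt (real N)) \<longlonglongrightarrow> 0" by real_asymp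
  have 3: "(\<lambda>N. 1 / real N) \<longlonglongrightarrow> 0" by real_asymp
  have "(\<lambda>N. (A * B + D) * (1 / sqrt (real N)) + B * (ln (real N) / sqrt (real N)) + E * F / 2 * (1 / real N))
    \<longlonglongrightarrow> (A * B + D) * 0 + B * 0 + E * F / 2 * 0"
    by (intro tendsto_intros 1 2 3)
  then show ?thesis by (simp add: algebra_simps add_divide_distrib)
qed

section \<open>Erlang distributions\<close>

text \<open>Clearing the positive normalisation turns the mean condition into a polynomial equation
  in \<open>\<rho>\<close>, suited to monotonicity and to the intermediate value theorem.\<close>

lemma erlang_mean_iff:
  assumes "0 < \<rho>"
  shows "(\<Sum>n\<le>C. real n * erlang C \<rho> n) = lam \<longleftrightarrow> (\<Sum>n\<le>C. (real n - lam) * (\<rho> ^ n / fact n)) = 0"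
proof -
  let ?Z = "\<Sum>k\<le>C. \<rho> ^ k / fact k"
  have Z: "?Z > 0" using assms by (intro sum_pos) auto
  have "(\<Sum>n\<le>C. real n * erlang C \<rho> n) = (\<Sum>n\<le>C. real n * (\<rho> ^ n / fact n)) / ?Z"
    by (simp add: erlang_def sum_divide_distrib)
  moreover have "(\<Sum>n\<le>C. (real n - lam) * (\<rho> ^ n / fact n)) = (\<Sum>n\<le>C. real n * (\<rho> ^ n / fact n)) - lam * ?Z"
    by (simp only: left_diff_distrib sum_subtractf sum_distrib_left)
  moreover have "t / z = lam \<longleftrightarrow> t - lam * z = 0" if "z > 0" for t z
    using that by (auto simp: field_simps)
  ultimately show ?thesis using Z by (simp only:)
qed

lemma erlang_mean_inj:
  assumes lam: "0 < lam" and "0 < r" "0 < s"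
    and r: "(\<Sum>n\<le>C. real n * erlang C r n) = lam" and s: "(\<Sum>n\<le>C. real n * erlang C s n) = lam"
  shows "r = s"
proof -
  \<comment> \<open>Multiplied by \<open>x powr - lam\<close>, each term of the equation for \<open>x\<close> is increasing in \<open>x\<close>.\<close>
  define h where "h x = (\<Sum>n\<le>C. (real n - lam) * x powr (real n - lam) / fact n)" for x
  have less: "h x < h y" if xy: "0 < x" "x < y" for x y
    unfolding h_def
  proof (rule sum_strict_mono_ex1)
    show "\<forall>n\<in>{..C}. (real n - lam) * x powr (real n - lam) / fact n \<le> (real n - lam) * y powr (real n - lam) / fact n"
    proof
      fix n
      show "(real n - lam) * x powr (real n - lam) / fact n \<le> (real n - lam) * y powr (real n - lam) / fact n"
      proof (cases "lam \<le> real n")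
        case True
        then show ?thesis using xy by (intro divide_right_mono mult_left_mono powr_mono2) auto
      next
        case False
        then show ?thesis using xy by (intro divide_right_mono mult_left_mono_neg powr_mono2') auto
      qed
    qed
    \<comment> \<open>Strictness comes from \<open>n = 0\<close>, whose coefficient
      \<open>- lam\<close> is negative.\<close>
    have "y powr - lam < x powr - lam" using xy lam by (intro powr_less_mono2_neg) auto
    then show "\<exists>n\<in>{..C}. (real n - lam) * x powr (real n - lam) / fact n < (real n - lam) * y powr (real n - lam) / fact n"
      using lam by (intro bexI[of _ 0]) auto
  qed simp
  have zero: "h x = 0" if "0 < x" "(\<Sum>n\<le>C. real n * erlang C x n) = lam" for x
  proof -
    have "h x = (\<Sum>n\<le>C. (real n - lam) * (x ^ n / fact n)) * x powr - lam"
      unfolding h_def sum_distrib_right using \<open>0 < x\<close>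
      by (intro sum.cong refl) (simp add: powr_diff powr_minus powr_realpow field_simps)
    then show ?thesis using erlang_mean_iff that by simp
  qed
  show ?thesis
    using less[of r s] less[of s r] zero[OF assms(2) r] zero[OF assms(3) s] assms(2,3) by linarith
qed

text \<open>Intermediate value theorem for the polynomial of \<open>erlang_mean_iff\<close>, which
  is negative at 0 and positive at a large \<open>R\<close>.\<close>

lemma erlang_mean_ex:
  assumes lam: "0 < lam" "lam < real C"
  shows "\<exists>\<rho>>0. (\<Sum>n\<le>C. real n * erlang C \<rho> n) = lam"
proof -
  define P where "P x = (\<Sum>n\<le>C. (real n - lam) * (x ^ n / fact n))" for x
  \<comment> \<open>Chosen so that \<open>(C - lam) / fact C * R\<close> exceeds
    \<open>lam * C\<close> by \<open>(C - lam) / fact C\<close>. The leading term then beats the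
    \<open>C\<close> lower terms, each at least \<open>- lam * R ^ (C - 1)\<close>.\<close>
  define R where "R = 1 + lam * real C * fact C / (real C - lam)"
  have d: "0 < real C - lam" using lam by simp
  have R: "R \<ge> 1" using lam by (simp add: R_def)
  obtain D where D: "C = Suc D" using lam by (cases C) auto
  have P0: "P 0 < 0" unfolding P_def using lam by (simp add: sum.remove[of _ 0] sum.neutral)
  have PR1: "P R = (real C - lam) * (R ^ C / fact C) + (\<Sum>n<C. (real n - lam) * (R ^ n / fact n))"
    by (simp add: P_def lessThan_Suc_atMost[symmetric])
  have PR2: "(\<Sum>n<C. - lam * R ^ D) \<le> (\<Sum>n<C. (real n - lam) * (R ^ n / fact n))"
  proof (rule sum_mono)
    fix n assume "n \<in> {..<C}"
    then have "n \<le> D" using D by simp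
    then have "R ^ n / fact n \<le> R ^ D / 1"
      using R by (intro frac_le power_increasing) (auto simp: fact_ge_1)
    then have "lam * (R ^ n / fact n) \<le> lam * R ^ D" using lam by (intro mult_left_mono) auto
    moreover have "0 \<le> real n * (R ^ n / fact n)" using R by simp
    ultimately show "- lam * R ^ D \<le> (real n - lam) * (R ^ n / fact n)"
      unfolding left_diff_distrib by linarith
  qed
  have "0 < R ^ D * ((real C - lam) / fact C)" using R d by simp
  also have "\<dots> = R ^ D * ((real C - lam) / fact C * R) + (\<Sum>n<C. - lam * R ^ D)"
  proof -
    have "(real C - lam) / fact C * R = (real C - lam) / fact C + lam * real C"
      using d by (simp add: R_def field_simps)
    then show ?thesis by (simp add: distrib_left)
  qed
  also have "R ^ D * ((real C - lam) / fact C * R) = (real C - lam) * (R ^ C / fact C)"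
    by (simp only: D power_Suc) simp
  also have "\<dots> + (\<Sum>n<C. - lam * R ^ D) \<le> P R" using PR1 PR2 by linarith
  finally have PR: "P R > 0" .
  have "\<exists>x\<ge>0. x \<le> R \<and> P x = 0"
    using P0 PR R by (intro IVT) (auto simp: P_def intro!: continuous_intros)
  then obtain x where "x \<ge> 0" "P x = 0" by auto
  moreover then have "x \<noteq> 0" using P0 by auto
  ultimately show ?thesis using erlang_mean_iff[of x C lam] by (intro exI[of _ x]) (simp add: P_def)
qed

lemma dissipation_nonneg: "0 \<le> dissipation C lam y"
  unfolding dissipation_def by (intro sum_nonneg) auto

text \<open>Vanishing dissipation is detailed balance between neighbouring levels with rate
  \<open>r = lam / (1 - y C)\<close>, where \<open>y C < 1\<close> because the mean is below
  \<open>C\<close>. The recursion gives the Erlang distribution of parameter \<open>r\<close>, and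
  its mean forces \<open>r = \<rho>\<close>.\<close>

lemma eq_erlangI:
  assumes y: "y \<in> prob_vectors C" and lam: "0 < lam" "lam < real C"
    and \<rho>: "0 < \<rho>" "(\<Sum>n\<le>C. real n * erlang C \<rho> n) = lam"
    and mean: "mean C y = lam" and diss: "dissipation C lam y = 0"
  shows "y = erlang C \<rho>"
proof -
  note nn = prob_vectorsD(1)[OF y]
  have "real C * y C < real C * 1" using mean_bounds(2)[OF y] mean lam by linarith
  then have yC: "y C < 1" using lam by (subst (asm) mult_less_cancel_left_pos) auto
  define r where "r = lam / (1 - y C)"
  have r: "r > 0" using lam yC by (simp add: r_def)
  have step: "y (Suc n) = r / real (Suc n) * y n" if n: "n < C" for n
  proof -
    have "(sqrt (lam * y n) - sqrt ((1 - y C) * (real (Suc n) * y (Suc n))))\<^sup>2 = 0"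
      using diss n unfolding dissipation_def
      by (subst (asm) sum_nonneg_eq_0_iff) auto
    then have "lam * y n = (1 - y C) * (real (Suc n) * y (Suc n))" by (simp del: of_nat_Suc)
    then show ?thesis using yC by (simp add: r_def field_simps del: of_nat_Suc)
  qed
  have yn: "y n = y 0 * (r ^ n / fact n)" if "n \<le> C" for n
    using that
  proof (induction n)
    case (Suc n)
    then show ?case using step[of n] by (simp add: field_simps del: of_nat_Suc) 
  qed simp
  let ?Z = "\<Sum>k\<le>C. r ^ k / fact k"
  have Z: "?Z > 0" using r by (intro sum_pos) auto
  have "(\<Sum>n\<le>C. y n) = y 0 * ?Z"
    unfolding sum_distrib_left by (intro sum.cong refl yn) simp
  then have "y 0 * ?Z = 1" using prob_vectorsD(3)[OF y] by simp
  then have y0: "y 0 = 1 / ?Z" using Z by (simp add: field_simps)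
  have eq: "y = erlang C r"
  proof
    fix n
    show "y n = erlang C r n"
    proof (cases "n \<le> C")
      case True
      show ?thesis unfolding yn[OF True] y0 using True by (simp add: erlang_def)
    next
      case False
      then show ?thesis using prob_vectorsD(2)[OF y, of n] by (simp add: erlang_def)
    qed
  qed
  then have "r = \<rho>"
    using erlang_mean_inj[OF lam(1) r \<rho>(1) _ \<rho>(2)] mean by (simp add: mean_def)
  then show ?thesis using eq by simp
qed

section \<open>Weak convergence\<close>

text \<open>A closed subset of a product of unit intervals, which is compact by Tychonoff's
  theorem.\<close>

lemma compact_prob_vectors: "compact (prob_vectors C)"
proof -
  have "compact (PiE UNIV (\<lambda>_. {0..1}) :: (nat \<Rightarrow> real) set)"
    using compactin_PiE[of "\<lambda>_. euclidean :: real topology" UNIV "\<lambda>_. {0..1}"]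
    by (simp add: euclidean_product_topology)
  moreover have coord: "continuous_on UNIV (\<lambda>y :: nat \<Rightarrow> real. y n)" for n
    by (rule continuous_on_product_coordinates)
  have "closed ((\<Inter>n\<in>{..C}. {y. 0 \<le> y n}) \<inter> (\<Inter>n\<in>{C<..}. {y. y n = 0}) \<inter> {y. (\<Sum>n\<le>C. y n) = 1} :: (nat \<Rightarrow> real) set)"
    by (intro closed_Int closed_INT ballI closed_Collect_le closed_Collect_eq continuous_on_sum continuous_on_const coord)
  moreover have "(\<Inter>n\<in>{..C}. {y. 0 \<le> y n}) \<inter> (\<Inter>n\<in>{C<..}. {y. y n = 0}) \<inter> {y. (\<Sum>n\<le>C. y n) = 1} = prob_vectors C"
    by (auto simp: prob_vectors_def)
  ultimately have "compact (PiE UNIV (\<lambda>_. {0..1}) \<inter> prob_vectors C)"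
    by (intro compact_Int_closed) auto
  moreover have "PiE UNIV (\<lambda>_. {0..1}) \<inter> prob_vectors C = prob_vectors C"
    using prob_vectorsD(1) prob_vectors_le_1 by (auto simp: PiE_def)
  ultimately show ?thesis by simp
qed

lemma erlang_in_prob_vectors:
  assumes "0 < \<rho>"
  shows "erlang C \<rho> \<in> prob_vectors C"
proof -
  let ?Z = "\<Sum>k\<le>C. \<rho> ^ k / fact k"
  have Z: "?Z > 0" using assms by (intro sum_pos) auto
  have "(\<Sum>n\<le>C. erlang C \<rho> n) = (\<Sum>n\<le>C. \<rho> ^ n / fact n / ?Z)"
    by (intro sum.cong) (auto simp: erlang_def)
  also have "\<dots> = 1" using Z by (simp only: sum_divide_distrib[symmetric]) simp
  finally have "(\<Sum>n\<le>C. erlang C \<rho> n) = 1" .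
  then show ?thesis using assms Z by (simp add: prob_vectors_def erlang_def)
qed

lemma integral_borel_law:
  fixes f :: "'a :: topological_space \<Rightarrow> real"
  assumes p: "set_pmf p \<subseteq> S" and f: "f \<in> borel_measurable (restrict_space borel S)"
  shows "(\<integral>x. f x \<partial>borel_law S p) = (\<integral>x. f x \<partial>measure_pmf p)"
proof -
  let ?N = "restrict_space borel S :: 'a measure"
  obtain x0 where x0: "x0 \<in> S" using p set_pmf_not_empty[of p] by blast
  \<comment> \<open>The identity need not map the whole type into \<open>S\<close>, so it is not measurable into \<open>?N\<close>.\<close>
  define g where "g x = (if x \<in> S then x else x0)" for x
  have ae: "AE x in measure_pmf p. g x = x"
    using p by (auto simp: g_def AE_measure_pmf_iff)
  \<comment> \<open>\<open>distr\<close> depends only on the measures of preimages, and these agree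
    because \<open>g\<close> is almost surely the identity.\<close>
  have "borel_law S p = distr (measure_pmf p) ?N g"
    unfolding borel_law_def distr_def
  proof (rule measure_of_eq)
    fix A assume "A \<in> sigma_sets (space ?N) (sets ?N)"
    show "emeasure (measure_pmf p) ((\<lambda>x. x) -` A \<inter> space (measure_pmf p))
        = emeasure (measure_pmf p) (g -` A \<inter> space (measure_pmf p))"
      by (rule emeasure_eq_AE) (use ae in auto)
  qed (rule sets.space_closed)
  moreover have "g \<in> measurable (measure_pmf p) ?N"
    using x0 by (auto simp: g_def space_restrict_space)
  ultimately have "(\<integral>x. f x \<partial>borel_law S p) = (\<integral>x. f (g x) \<partial>measure_pmf p)"
    using f by (simp add: integral_distr)
  also have "\<dots> = (\<integral>x. f x \<partial>measure_pmf p)"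
    by (rule integral_cong_AE) (use ae in auto)
  finally show ?thesis .
qed

text \<open>On the compact set where \<open>\<bar>f x\<bar> \<ge> e\<close>, \<open>G\<close> has a
  positive minimum, so the maximum of \<open>\<bar>f\<bar>\<close> over that minimum serves as
  \<open>M\<close>; elsewhere \<open>e\<close> suffices. This turns convergence of the expectation
  of \<open>G\<close> to 0 into that of \<open>f\<close>.\<close>

lemma continuous_le_eps_plus_multiple:
  fixes f G :: "'a :: topological_space \<Rightarrow> real"
  assumes K: "compact K" and f: "continuous_on K f" and G: "continuous_on K G"
    and nonneg: "\<And>x. x \<in> K \<Longrightarrow> 0 \<le> G x" and zero: "\<And>x. x \<in> K \<Longrightarrow> G x = 0 \<Longrightarrow> f x = 0" and e: "0 < e"
  obtains M where "0 \<le> M" "\<And>x. x \<in> K \<Longrightarrow> \<bar>f x\<bar> \<le> e + M * G x"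
proof -
  let ?A = "{x \<in> K. e \<le> \<bar>f x\<bar>}"
  have "compact ?A"
  proof -
    have "closedin (top_of_set K) ?A"
      using continuous_closedin_preimage[OF continuous_on_rabs[OF f] closed_atLeast[of e]]
      by (simp add: vimage_def Int_def)
    then show ?thesis using K closedin_compact by blast
  qed
  show ?thesis
  proof (cases "?A = {}")
    case True
    then show ?thesis by (intro that[of 0]) (auto simp: not_le intro: less_imp_le)
  next
    case False
    obtain x1 where x1: "x1 \<in> ?A" "\<And>x. x \<in> ?A \<Longrightarrow> G x1 \<le> G x"
      using continuous_attains_inf[OF \<open>compact ?A\<close> False continuous_on_subset[OF G]] by blast
    obtain x2 where x2: "x2 \<in> ?A" "\<And>x. x \<in> ?A \<Longrightarrow> \<bar>f x\<bar> \<le> \<bar>f x2\<bar>"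
      using continuous_attains_sup[OF \<open>compact ?A\<close> False continuous_on_subset[OF continuous_on_rabs[OF f]]] by blast
    have "G x1 > 0" using x1 nonneg[of x1] zero[of x1] e by (cases "G x1 = 0") auto
    show ?thesis
    proof (rule that[of "\<bar>f x2\<bar> / G x1"])
      show "0 \<le> \<bar>f x2\<bar> / G x1" using \<open>G x1 > 0\<close> by simp
      fix x assume x: "x \<in> K"
      show "\<bar>f x\<bar> \<le> e + \<bar>f x2\<bar> / G x1 * G x"
      proof (cases "x \<in> ?A")
        case True
        have "\<bar>f x\<bar> \<le> \<bar>f x2\<bar> / G x1 * G x1" using x2(2)[OF True] \<open>G x1 > 0\<close> by simp
        also have "\<dots> \<le> \<bar>f x2\<bar> / G x1 * G x" using x1(2)[OF True] \<open>G x1 > 0\<close> by (intro mult_left_mono) auto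
        finally show ?thesis using e by linarith
      next
        case False
        then have "\<bar>f x\<bar> \<le> e" using x by auto
        moreover have "0 \<le> \<bar>f x2\<bar> / G x1 * G x" using nonneg[OF x] \<open>G x1 > 0\<close> by simp
        ultimately show ?thesis by linarith
      qed
    qed
  qed
qed

text \<open>\<open>?G\<close> penalises both dissipation and deviation of the mean, so on the
  simplex it vanishes only at the Erlang distribution. Its expectation tends to 0, and
  \<open>continuous_le_eps_plus_multiple\<close> bounds the oscillation of \<open>f\<close> around
  that point by \<open>?G\<close>.\<close>

lemma tendsto_invariant_expectation:
  assumes lam: "0 < lam" "lam < real C"
    and inv: "\<And>N. N \<ge> 1 \<Longrightarrow> invariant_distribution (network_states C N) (network_rate C lam N) (\<pi> N)"
    and \<rho>: "0 < \<rho>" "(\<Sum>n\<le>C. real n * erlang C \<rho> n) = lam"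
    and f: "continuous_on (prob_vectors C) f"
  shows "(\<lambda>N. \<Sum>y\<in>network_states C N. pmf (\<pi> N) y * f y) \<longlonglongrightarrow> f (erlang C \<rho>)"
proof -
  let ?S = "network_states C" and ?v = "erlang C \<rho>"
  let ?G = "\<lambda>y. 2 * dissipation C lam y + (mean C y - lam)\<^sup>2"
  let ?E = "\<lambda>N h. \<Sum>y\<in>?S N. pmf (\<pi> N) y * h y"
  have one: "?E N (\<lambda>_. 1) = 1" if "N \<ge> 1" for N
    using sum_pmf_eq_1[OF finite_network_states[OF that]] inv[OF that] by (simp add: invariant_distribution_def)
  have EG: "(\<lambda>N. ?E N ?G) \<longlonglongrightarrow> 0"
  proof (rule tendsto_sandwich[OF _ _ tendsto_const])
    let ?b = "\<lambda>N. (\<bar>ln lam\<bar> + ln (real N)) * ((1 + (lam + real C) / 2) / sqrt (real N))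
      + 2 * real C * (sqrt (lam * real C) + sqrt (2 * real C * real C * lam / (real C - lam))) / sqrt (real N)
      + 8 * real C * sqrt (real C * lam) / (real C - lam)\<^sup>2 * ((lam + real C) / (2 * real N))"
    have "(\<lambda>N. (lam + real C) / (2 * real N)) \<longlonglongrightarrow> 0" by real_asymp
    then have "(\<lambda>N. ?b N + (lam + real C) / (2 * real N)) \<longlonglongrightarrow> 0 + 0"
      by (intro tendsto_add tendsto_dissipation_bound)
    then show "(\<lambda>N. ?b N + (lam + real C) / (2 * real N)) \<longlonglongrightarrow> 0" by (simp only: add_0_left)
    show "eventually (\<lambda>N. ?E N ?G \<le> ?b N + (lam + real C) / (2 * real N)) sequentially"
      using eventually_ge_at_top[of 1]
    proof eventually_elim
      case (elim N)
      have "?E N ?G = 2 * ?E N (dissipation C lam) + ?E N (\<lambda>y. (mean C y - lam)\<^sup>2)"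
        by (simp add: distrib_left sum.distrib sum_distrib_left mult_ac)
      then show ?case
        using invariant_dissipation_le[OF elim lam inv[OF elim]] invariant_mean_square[OF elim lam inv[OF elim]]
        by linarith
    qed
    show "eventually (\<lambda>N. 0 \<le> ?E N ?G) sequentially"
      by (intro always_eventually allI sum_nonneg mult_nonneg_nonneg add_nonneg_nonneg) (auto simp: dissipation_nonneg)
  qed
  have contG: "continuous_on (prob_vectors C) ?G"
    unfolding dissipation_def mean_def
    by (intro continuous_intros continuous_on_subset[OF continuous_on_product_coordinates]) auto
  have v: "?v \<in> prob_vectors C" by (rule erlang_in_prob_vectors[OF \<rho>(1)])
  have Gzero: "y = ?v" if "y \<in> prob_vectors C" "?G y = 0" for y
  proof (rule eq_erlangI[OF that(1) lam \<rho>])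
    have "dissipation C lam y = 0" "(mean C y - lam)\<^sup>2 = 0"
      using that(2) dissipation_nonneg[of C lam y] zero_le_power2[of "mean C y - lam"] by linarith+
    then show "mean C y = lam" "dissipation C lam y = 0" by auto
  qed
  show ?thesis
  proof (rule LIMSEQ_I)
    fix e :: real assume "0 < e"
    have contf: "continuous_on (prob_vectors C) (\<lambda>y. f y - f ?v)"
      by (intro continuous_intros f)
    obtain M where M: "0 \<le> M" "\<And>y. y \<in> prob_vectors C \<Longrightarrow> \<bar>f y - f ?v\<bar> \<le> e / 2 + M * ?G y"
    proof (rule continuous_le_eps_plus_multiple[OF compact_prob_vectors contf contG, of "e / 2"])
      show "0 \<le> ?G y" for y using dissipation_nonneg[of C lam y] by simp
      show "f y - f ?v = 0" if "y \<in> prob_vectors C" "?G y = 0" for y using Gzero[OF that] by simp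
    qed (use \<open>0 < e\<close> in auto)
    have "(\<lambda>N. M * ?E N ?G) \<longlonglongrightarrow> M * 0" by (intro tendsto_intros EG)
    then have "eventually (\<lambda>N. M * ?E N ?G < e / 2) sequentially"
      using \<open>0 < e\<close> by (intro order_tendstoD(2)[of _ 0]) auto
    then have "eventually (\<lambda>N. norm (?E N f - f ?v) < e) sequentially"
      using eventually_ge_at_top[of 1]
    proof eventually_elim
      case (elim N)
      have "?E N f - f ?v = ?E N f - ?E N (\<lambda>_. 1) * f ?v" using one[OF elim(2)] by simp
      also have "\<dots> = ?E N (\<lambda>y. f y - f ?v)"
        by (simp add: right_diff_distrib sum_subtractf sum_distrib_right)
      finally have "norm (?E N f - f ?v) \<le> (\<Sum>y\<in>?S N. \<bar>pmf (\<pi> N) y * (f y - f ?v)\<bar>)" by (simp add: sum_abs)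
      also have "\<dots> \<le> ?E N (\<lambda>y. e / 2 + M * ?G y)"
        unfolding abs_mult using M(2) network_statesD(1) by (intro sum_mono mult_mono) auto
      also have "\<dots> = ?E N (\<lambda>_. 1) * (e / 2) + M * ?E N ?G"
      proof -
        have "?E N (\<lambda>y. e / 2 + M * g y) = ?E N (\<lambda>_. 1) * (e / 2) + M * ?E N g" for g
          by (simp add: distrib_left sum.distrib sum_distrib_left sum_divide_distrib sum_distrib_right mult_ac)
        then show ?thesis .
      qed
      also have "\<dots> < e" using one[OF elim(2)] elim(1) by simp
      finally show ?case .
    qed
    then show "\<exists>N0. \<forall>N\<ge>N0. norm (?E N f - f ?v) < e" by (simp add: eventually_sequentially)
  qed
qed

theorem proposition4p4:
  fixes C :: nat and lam :: real
  assumes "C \<ge> 1" and "0 < lam" and "lam < real C"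
  shows "(\<forall>N\<ge>1. irreducible_jump (network_states C N) (network_rate C lam N) \<and>
            (\<exists>!p. invariant_distribution (network_states C N) (network_rate C lam N) p)) \<and>
         (\<exists>!\<rho>. 0 < \<rho> \<and> (\<Sum>n\<le>C. real n * erlang C \<rho> n) = lam) \<and>
         (\<forall>\<pi> \<rho>.
            (\<forall>N\<ge>1. invariant_distribution (network_states C N) (network_rate C lam N) (\<pi> N)) \<longrightarrow>
            0 < \<rho> \<and> (\<Sum>n\<le>C. real n * erlang C \<rho> n) = lam \<longrightarrow>
            weak_conv_on (prob_vectors C)
              (\<lambda>N. borel_law (prob_vectors C) (\<pi> N))
              (return (restrict_space borel (prob_vectors C)) (erlang C \<rho>)))"
proof (intro conjI allI impI)
  show "irreducible_jump (network_states C N) (network_rate C lam N)" if "N \<ge> 1" for N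
    by (rule irreducible_network[OF that assms(2)])
  show "\<exists>!p. invariant_distribution (network_states C N) (network_rate C lam N) p" if "N \<ge> 1" for N
    by (rule ex1_network_invariant[OF that assms(2)])
  show "\<exists>!\<rho>. 0 < \<rho> \<and> (\<Sum>n\<le>C. real n * erlang C \<rho> n) = lam"
    using erlang_mean_ex[OF assms(2,3)] erlang_mean_inj[OF assms(2)] by blast
next
  fix \<pi> \<rho>
  assume "\<forall>N\<ge>1. invariant_distribution (network_states C N) (network_rate C lam N) (\<pi> N)"
  then have inv: "invariant_distribution (network_states C N) (network_rate C lam N) (\<pi> N)" if "N \<ge> 1" for N
    using that by blast
  assume \<rho>: "0 < \<rho> \<and> (\<Sum>n\<le>C. real n * erlang C \<rho> n) = lam"
  let ?P = "prob_vectors C"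
  show "weak_conv_on ?P (\<lambda>N. borel_law ?P (\<pi> N)) (return (restrict_space borel ?P) (erlang C \<rho>))"
    unfolding weak_conv_on_def
  proof (intro allI impI)
    fix f :: "(nat \<Rightarrow> real) \<Rightarrow> real"
    assume "continuous_on ?P f \<and> bounded (f ` ?P)"
    then have f: "continuous_on ?P f" by simp
    note meas = borel_measurable_continuous_on_restrict[OF f]
    have "(\<integral>x. f x \<partial>return (restrict_space borel ?P) (erlang C \<rho>)) = f (erlang C \<rho>)"
      using erlang_in_prob_vectors \<rho> meas by (intro integral_return) (auto simp: space_restrict_space)
    \<comment> \<open>Only eventually, as nothing is assumed about \<open>\<pi> 0\<close>.\<close>
    moreover have "eventually (\<lambda>N. (\<Sum>y\<in>network_states C N. pmf (\<pi> N) y * f y)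
        = (\<integral>x. f x \<partial>borel_law ?P (\<pi> N))) sequentially"
      using eventually_ge_at_top[of 1]
    proof eventually_elim
      case (elim N)
      have sub: "set_pmf (\<pi> N) \<subseteq> network_states C N"
        using inv[OF elim] by (simp add: invariant_distribution_def)
      then have "set_pmf (\<pi> N) \<subseteq> ?P" using network_statesD(1) by blast
      from integral_borel_law[OF this meas]
      have "(\<integral>x. f x \<partial>borel_law ?P (\<pi> N)) = (\<Sum>y\<in>network_states C N. f y * pmf (\<pi> N) y)"
        using sub finite_network_states[OF elim] by (subst (asm) integral_measure_pmf_real) auto
      then show ?case by (simp add: mult.commute)
    qed
    ultimately show "(\<lambda>N. \<integral>x. f x \<partial>borel_law ?P (\<pi> N))
        \<longlonglongrightarrow> (\<integral>x. f x \<partial>return (restrict_space borel ?P) (erlang C \<rho>))"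
      using tendsto_invariant_expectation[OF assms(2,3) inv _ _ f] \<rho>
      by (auto intro: Lim_transform_eventually)
  qed
qed

end
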